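(* The algebra $\overline{AW}(\tfrac12,\tfrac12,\tfrac12)$ is isomorphic to the Temperley--Lieb algebra $TL_3(q)$. An isomorphism $\overline{AW}(\tfrac12,\tfrac12,\tfrac12)\to TL_3(q)$ is given explicitly by $$\tilde A\mapsto (q+q^{-1})-\sigma_1,\qquad \tilde B\mapsto (q+q^{-1})-\sigma_2,$$ where $\tilde A,\tilde B\in\overline{AW}(\tfrac12,\tfrac12,\tfrac12)$ are defined by $A=(q-q^{-1})^2\tilde A+q+q^{-1}$ and $B=(q-q^{-1})^2\tilde B+q+q^{-1}$.
   Context: Throughout, $q\in\mathbb{C}$ is nonzero and not a root of unity, and all algebras are unital associative algebras over $\mathbb{C}$. The Temperley--Lieb algebra $TL_3(q)$ is generated by $\sigma_1,\sigma_2$ with defining relations $\sigma_1^2=(q+q^{-1})\sigma_1$, $\sigma_2^2=(q+q^{-1})\sigma_2$, $\sigma_1\sigma_2\sigma_1=\sigma_1$, $\sigma_2\sigma_1\sigma_2=\sigma_2$. For $j\in\{0,\tfrac12,1,\dots\}$ put $\chi_j=q^{2j+1}+q^{-2j-1}$. Sets: $\mathcal{J}(j_1,j_2)=\{|j_1-j_2|,|j_1-j_2|+1,\dots,j_1+j_2\}$, $\mathcal{J}(j_1,j_2,j_3)=\bigcup_{j\in\mathcal{J}(j_1,j_2)}\mathcal{J}(j,j_3)$, $\mathcal{M}(j_a,j_b,j_c)=\bigcup_{j\in\mathcal{J}(j_a,j_b)}\{\chi_\ell-\chi_j : \ell\in\mathcal{J}(j,j_c)\}$ (all sets without repetition). With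 $[X,Y]_q=qXY-q^{-1}YX$, the centrally extended Askey--Wilson algebra $AW(3)$ is the algebra generated by $A,B,D$ and central elements $\alpha_1,\alpha_2,\alpha_3,K$ with defining relations $$A+\frac{[B,D]_q}{q^2-q^{-2}}=\frac{\alpha_1\alpha_2+\alpha_3K}{q+q^{-1}},\quad B+\frac{[D,A]_q}{q^2-q^{-2}}=\frac{\alpha_2\alpha_3+\alpha_1K}{q+q^{-1}},\quad D+\frac{[A,B]_q}{q^2-q^{-2}}=\frac{\alpha_1\alpha_3+\alpha_2K}{q+q^{-1}}.$$ The element $D'\in AW(3)$ is defined by $D'+\frac{[B,A]_q}{q^2-q^{-2}}=\frac{\alpha_1\alpha_3+\alpha_2K}{q+q^{-1}}$, and $$\Omega=qA(\alpha_1\alpha_2+\alpha_3K)+q^{-1}B(\alpha_2\alpha_3+\alpha_1K)+qD(\alpha_1\alpha_3+\alpha_2K)-q^2A^2-q^{-2}B^2-q^2D^2-qABD.$$ The algebra $\overline{AW}(j_1,j_2,j_3)$ is the quotient of $AW(3)$ by the relations: $\alpha_i=\chi_{j_i}$ ($i=1,2,3$); $\prod_{j\in\mathcal{J}(j_1,j_2)}(A-\chi_j)=0$; $\prod_{j\in\mathcal{J}(j_2,j_3)}(B-\chi_j)=0$; $\prod_{j\in\mathcal{J}(j_1,j_2,j_3)}(K-\chi_j)=0$; $\prod_{j\in\mathcal{J}(j_1,j_3)}(D-\chi_j)=0$; $\prod_{j\in\mathcal{J}(j_1,j_3)}(D'-\chi_j)=0$; $\prod_{m\in\mathcal{M}(j_1,j_2,j_3)}(K-A-m)=0$;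 $\prod_{m\in\mathcal{M}(j_2,j_3,j_1)}(K-B-m)=0$; $\prod_{m\in\mathcal{M}(j_1,j_3,j_2)}(K-D-m)=0$; $\prod_{m\in\mathcal{M}(j_1,j_3,j_2)}(K-D'-m)=0$; and $\Omega=\chi_{j_1}^2+\chi_{j_2}^2+\chi_{j_3}^2+K^2+\chi_{j_1}\chi_{j_2}\chi_{j_3}K-(q+q^{-1})^2$. *)

theory Defs
  imports "HOL-Algebra.QuotRing" "HOL-Algebra.Module" "HOL-Library.Poly_Mapping" Complex_Main
begin

text \<open>
  A (not necessarily commutative) unital complex algebra is a HOL-Algebra ring together with a
  scalar multiplication, packed in the record type \<^typ>\<open>(complex, 'a) module\<close>.

  The free algebra is the monoid algebra of the free monoid. \<open>'g fmon\<close> is that free monoid (words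
  over the alphabet \<^typ>\<open>'g\<close>); its operation, concatenation, has to be written additively (it is
  not commutative), because the convolution product on \<open>\<Rightarrow>\<^sub>0\<close> is the one
  induced by the addition of the exponents.
\<close>

datatype 'g fmon = Word "'g list"

instantiation fmon :: (type) monoid_add
begin

definition zero_fmon :: "'a fmon" where "zero_fmon = Word []"

fun plus_fmon :: "'a fmon \<Rightarrow> 'a fmon \<Rightarrow> 'a fmon" where
  "plus_fmon (Word u) (Word v) = Word (u @ v)"

instance
proof
  fix a b c :: "'a fmon"
  show "a + b + c = a + (b + c)" by (cases a; cases b; cases c) simp
  show "0 + a = a" by (cases a) (simp add: zero_fmon_def)
  show "a + 0 = a" by (cases a) (simp add: zero_fmon_def)
qed

end

type_synonym 'g free = "'g fmon \<Rightarrow>\<^sub>0 complex"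

definition gen :: "'g \<Rightarrow> 'g free" where
  "gen g = Poly_Mapping.single (Word [g]) 1"

definition cst :: "complex \<Rightarrow> 'g free" where
  "cst c = Poly_Mapping.single 0 c"

definition free_alg :: "(complex, 'g free) module" where
  "free_alg = \<lparr>carrier = UNIV, mult = (*), one = 1, zero = 0, add = (+),
     smult = (\<lambda>c x. cst c * x)\<rparr>"

text \<open>
  Quotient of an algebra by the two-sided ideal generated by \<open>S\<close>. The scalar multiplication on
  cosets is given by \<open>c \<odot> (I + x) = I + c \<odot> x\<close>, see \<open>smult_alg_cls\<close> below.
\<close>

definition alg_quot :: "(complex, 'a) module \<Rightarrow> 'a set \<Rightarrow> (complex, 'a set) module" where
  "alg_quot R S = ring.extend (R Quot (Idl\<^bsub>R\<^esub> S))
     (module.fields (\<lambda>c X. \<Union>x\<in>X. Idl\<^bsub>R\<^esub> S +>\<^bsub>R\<^esub> (c \<odot>\<^bsub>R\<^esub> x)))"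

definition alg_cls :: "(complex, 'a) module \<Rightarrow> 'a set \<Rightarrow> 'a \<Rightarrow> 'a set" where
  "alg_cls R S x = Idl\<^bsub>R\<^esub> S +>\<^bsub>R\<^esub> x"

definition alg_iso :: "(complex, 'a) module \<Rightarrow> (complex, 'b) module \<Rightarrow> ('a \<Rightarrow> 'b) set" where
  "alg_iso R S = {h \<in> ring_iso R S.
     \<forall>c. \<forall>x \<in> carrier R. h (c \<odot>\<^bsub>R\<^esub> x) = c \<odot>\<^bsub>S\<^esub> h x}"

lemma ring_free_alg: "ring (free_alg :: (complex, 'g free) module)"
proof (rule ringI)
  show "abelian_group (free_alg :: (complex, 'g free) module)"
  proof (rule abelian_groupI)
    fix x :: "'g free"
    assume "x \<in> carrier free_alg"
    show "\<exists>y\<in>carrier free_alg. y \<oplus>\<^bsub>free_alg\<^esub> x = \<zero>\<^bsub>free_alg\<^esub>"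
      by (rule bexI[of _ "- x"]) (simp_all add: free_alg_def)
  qed (simp_all add: free_alg_def add_ac)
  show "Group.monoid (free_alg :: (complex, 'g free) module)"
    by (rule monoidI) (simp_all add: free_alg_def mult.assoc)
qed (simp_all add: free_alg_def algebra_simps)

lemma smult_alg_cls:
  assumes R: "ring R" and S: "S \<subseteq> carrier R" and x: "x \<in> carrier R"
    and smult_closed: "\<And>c x. x \<in> carrier R \<Longrightarrow> c \<odot>\<^bsub>R\<^esub> x \<in> carrier R"
    and smult_add: "\<And>c x y. x \<in> carrier R \<Longrightarrow> y \<in> carrier R \<Longrightarrow>
           c \<odot>\<^bsub>R\<^esub> (x \<oplus>\<^bsub>R\<^esub> y) = c \<odot>\<^bsub>R\<^esub> x \<oplus>\<^bsub>R\<^esub> c \<odot>\<^bsub>R\<^esub> y"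
    and smult_mult: "\<And>c x y. x \<in> carrier R \<Longrightarrow> y \<in> carrier R \<Longrightarrow>
           c \<odot>\<^bsub>R\<^esub> (x \<otimes>\<^bsub>R\<^esub> y) = (c \<odot>\<^bsub>R\<^esub> x) \<otimes>\<^bsub>R\<^esub> y"
  shows "c \<odot>\<^bsub>alg_quot R S\<^esub> alg_cls R S x = alg_cls R S (c \<odot>\<^bsub>R\<^esub> x)"
proof -
  interpret ring R by fact
  define I where "I = Idl\<^bsub>R\<^esub> S"
  interpret I: ideal I R unfolding I_def by (rule genideal_ideal[OF S])
  have cI: "c \<odot>\<^bsub>R\<^esub> i \<in> I" if i: "i \<in> I" for i
  proof -
    have ic: "i \<in> carrier R" using i I.a_subset by blast
    have "c \<odot>\<^bsub>R\<^esub> i = (c \<odot>\<^bsub>R\<^esub> \<one>\<^bsub>R\<^esub>) \<otimes>\<^bsub>R\<^esub> i"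
      using smult_mult[of "\<one>\<^bsub>R\<^esub>" i c] ic by simp
    then show ?thesis using I.I_l_closed[OF i] smult_closed by simp
  qed
  have eq: "I +>\<^bsub>R\<^esub> (c \<odot>\<^bsub>R\<^esub> (i \<oplus>\<^bsub>R\<^esub> x)) = I +>\<^bsub>R\<^esub> (c \<odot>\<^bsub>R\<^esub> x)" if i: "i \<in> I" for i
  proof -
    have ic: "i \<in> carrier R" using i I.a_subset by blast
    have "c \<odot>\<^bsub>R\<^esub> (i \<oplus>\<^bsub>R\<^esub> x) \<in> I +>\<^bsub>R\<^esub> (c \<odot>\<^bsub>R\<^esub> x)"
      using cI[OF i] smult_add[OF ic x] by (auto simp: a_r_coset_def')
    then show ?thesis
      using a_repr_independence[OF _ smult_closed[OF x] I.a_subgroup] by simp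
  qed
  have "I \<noteq> {}" using I.zero_closed by blast
  then have "(\<Union>y\<in>I +>\<^bsub>R\<^esub> x. I +>\<^bsub>R\<^esub> (c \<odot>\<^bsub>R\<^esub> y)) = I +>\<^bsub>R\<^esub> (c \<odot>\<^bsub>R\<^esub> x)"
    using eq by (auto simp: a_r_coset_def'[where H=I and a=x])
  then show ?thesis
    by (simp add: alg_quot_def alg_cls_def ring.extend_def module.fields_def I_def)
qed

text \<open>
  The product \<open>\<Prod>s\<in>S. (x - f s)\<close> in the noncommutative free algebra, for a finite set \<open>S\<close> and scalars
  \<open>f s\<close>. It is independent of the order of the factors because they commute pairwise.
\<close>

definition lin_prod :: "('i \<Rightarrow> complex) \<Rightarrow> 'i set \<Rightarrow> 'g free \<Rightarrow> 'g free" where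
  "lin_prod f S x = Finite_Set.fold (\<lambda>s y. (x - cst (f s)) * y) 1 S"

lemma cst_central: "cst c * x = x * (cst c :: 'g free)"
proof (induction x rule: update_induct)
  case const
  show ?case by simp
next
  case (update f a b)
  have "Poly_Mapping.update a b f = f + Poly_Mapping.single a b"
    using update(1) by (intro poly_mapping_eqI)
      (auto simp: lookup_update lookup_add lookup_single when_def in_keys_iff)
  moreover have "cst c * Poly_Mapping.single a b = Poly_Mapping.single a b * cst c"
    by (simp add: cst_def mult_single mult.commute)
  ultimately show ?case using update(3) by (simp add: algebra_simps)
qed

lemma cst_add: "cst (c + d) = (cst c + cst d :: 'g free)"
  by (simp add: cst_def single_add)

lemma cst_mult: "cst (c * d) = (cst c * cst d :: 'g free)"
  by (simp add: cst_def mult_single)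

lemma cst_1: "cst 1 = (1 :: 'g free)"
  by (simp add: cst_def)

lemma comp_fun_commute_lin_prod:
  "comp_fun_commute (\<lambda>s y. (x - cst (f s)) * (y :: 'g free))"
proof
  fix s t
  have "(x - cst (f t)) * (x - cst (f s)) = (x - cst (f s)) * (x - cst (f t) :: 'g free)"
    using cst_central[of "f s" x] cst_central[of "f t" x] cst_central[of "f s" "cst (f t) :: 'g free"]
    by (simp add: algebra_simps)
  then show "(\<lambda>y. (x - cst (f t)) * y) \<circ> (\<lambda>y. (x - cst (f s)) * y)
      = (\<lambda>y. (x - cst (f s)) * y) \<circ> (\<lambda>y. (x - cst (f t)) * (y :: 'g free))"
    by (simp add: fun_eq_iff flip: mult.assoc)
qed

lemma lin_prod_empty: "lin_prod f {} x = 1"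
  by (simp add: lin_prod_def)

lemma lin_prod_insert:
  assumes "finite S" "s \<notin> S"
  shows "lin_prod f (insert s S) x = (x - cst (f s)) * lin_prod f S x"
proof -
  interpret comp_fun_commute "\<lambda>s y. (x - cst (f s)) * y" by (rule comp_fun_commute_lin_prod)
  show ?thesis using assms by (simp add: lin_prod_def)
qed

datatype tl_gen = S1 | S2

abbreviation \<sigma>1 :: "tl_gen free" where "\<sigma>1 \<equiv> gen S1"
abbreviation \<sigma>2 :: "tl_gen free" where "\<sigma>2 \<equiv> gen S2"

definition tl_rels :: "complex \<Rightarrow> tl_gen free set" where
  "tl_rels q = {
     \<sigma>1 * \<sigma>1 - cst (q + inverse q) * \<sigma>1,
     \<sigma>2 * \<sigma>2 - cst (q + inverse q) * \<sigma>2,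
     \<sigma>1 * \<sigma>2 * \<sigma>1 - \<sigma>1,
     \<sigma>2 * \<sigma>1 * \<sigma>2 - \<sigma>2}"

definition TL3 :: "complex \<Rightarrow> (complex, tl_gen free set) module" where
  "TL3 q = alg_quot free_alg (tl_rels q)"

definition TL3_cls :: "complex \<Rightarrow> tl_gen free \<Rightarrow> tl_gen free set" where
  "TL3_cls q = alg_cls free_alg (tl_rels q)"

text \<open>
  Spins are rational numbers \<open>j \<in> {0, 1/2, 1, ...}\<close>. For these \<open>2 * j + 1\<close> is an integer, so the floor
  in the exponent is only a type conversion.
\<close>

definition chi :: "complex \<Rightarrow> rat \<Rightarrow> complex" where
  "chi q j = q powi \<lfloor>2 * j + 1\<rfloor> + q powi (- \<lfloor>2 * j + 1\<rfloor>)"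

definition J2 :: "rat \<Rightarrow> rat \<Rightarrow> rat set" where
  "J2 j1 j2 = {\<bar>j1 - j2\<bar> + of_nat n | n. \<bar>j1 - j2\<bar> + of_nat n \<le> j1 + j2}"

definition J3 :: "rat \<Rightarrow> rat \<Rightarrow> rat \<Rightarrow> rat set" where
  "J3 j1 j2 j3 = (\<Union>j\<in>J2 j1 j2. J2 j j3)"

definition Mset :: "complex \<Rightarrow> rat \<Rightarrow> rat \<Rightarrow> rat \<Rightarrow> complex set" where
  "Mset q ja jb jc = (\<Union>j\<in>J2 ja jb. {chi q l - chi q j | l. l \<in> J2 j jc})"

datatype aw_gen = GA | GB | GD | G\<alpha>1 | G\<alpha>2 | G\<alpha>3 | GK

abbreviation gA :: "aw_gen free" where "gA \<equiv> gen GA"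
abbreviation gB :: "aw_gen free" where "gB \<equiv> gen GB"
abbreviation gD :: "aw_gen free" where "gD \<equiv> gen GD"
abbreviation \<alpha>1 :: "aw_gen free" where "\<alpha>1 \<equiv> gen G\<alpha>1"
abbreviation \<alpha>2 :: "aw_gen free" where "\<alpha>2 \<equiv> gen G\<alpha>2"
abbreviation \<alpha>3 :: "aw_gen free" where "\<alpha>3 \<equiv> gen G\<alpha>3"
abbreviation gK :: "aw_gen free" where "gK \<equiv> gen GK"

definition qcomm :: "complex \<Rightarrow> 'g free \<Rightarrow> 'g free \<Rightarrow> 'g free" where
  "qcomm q X Y = cst q * X * Y - cst (inverse q) * Y * X"

definition aw3_rels :: "complex \<Rightarrow> aw_gen free set" where
  "aw3_rels q =
     {gen z * gen g - gen g * gen z | z g. z \<in> {G\<alpha>1, G\<alpha>2, G\<alpha>3, GK}} \<union>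
     {gA + cst (1 / (q powi 2 - q powi -2)) * qcomm q gB gD
        - cst (1 / (q + inverse q)) * (\<alpha>1 * \<alpha>2 + \<alpha>3 * gK),
      gB + cst (1 / (q powi 2 - q powi -2)) * qcomm q gD gA
        - cst (1 / (q + inverse q)) * (\<alpha>2 * \<alpha>3 + \<alpha>1 * gK),
      gD + cst (1 / (q powi 2 - q powi -2)) * qcomm q gA gB
        - cst (1 / (q + inverse q)) * (\<alpha>1 * \<alpha>3 + \<alpha>2 * gK)}"

definition AW3 :: "complex \<Rightarrow> (complex, aw_gen free set) module" where
  "AW3 q = alg_quot free_alg (aw3_rels q)"

definition AW3_cls :: "complex \<Rightarrow> aw_gen free \<Rightarrow> aw_gen free set" where
  "AW3_cls q = alg_cls free_alg (aw3_rels q)"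

text \<open>
  \<open>Dprime\<close>, \<open>\<Omega>\<close>, the relators of \<open>AWbar\<close>, and \<open>Atilde\<close>, \<open>Btilde\<close> are representatives in the free
  algebra; the elements meant are their classes under \<open>AW3_cls\<close> or \<open>AWbar_cls\<close>.
\<close>

definition Dprime :: "complex \<Rightarrow> aw_gen free" where
  "Dprime q = cst (1 / (q + inverse q)) * (\<alpha>1 * \<alpha>3 + \<alpha>2 * gK)
     - cst (1 / (q powi 2 - q powi -2)) * qcomm q gB gA"

definition \<Omega> :: "complex \<Rightarrow> aw_gen free" where
  "\<Omega> q = cst q * gA * (\<alpha>1 * \<alpha>2 + \<alpha>3 * gK)
     + cst (inverse q) * gB * (\<alpha>2 * \<alpha>3 + \<alpha>1 * gK)
     + cst q * gD * (\<alpha>1 * \<alpha>3 + \<alpha>2 * gK)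
     - cst (q powi 2) * gA * gA - cst (q powi -2) * gB * gB - cst (q powi 2) * gD * gD
     - cst q * gA * gB * gD"

definition awbar_rels :: "complex \<Rightarrow> rat \<Rightarrow> rat \<Rightarrow> rat \<Rightarrow> aw_gen free set" where
  "awbar_rels q j1 j2 j3 = {
     \<alpha>1 - cst (chi q j1), \<alpha>2 - cst (chi q j2), \<alpha>3 - cst (chi q j3),
     lin_prod (chi q) (J2 j1 j2) gA,
     lin_prod (chi q) (J2 j2 j3) gB,
     lin_prod (chi q) (J3 j1 j2 j3) gK,
     lin_prod (chi q) (J2 j1 j3) gD,
     lin_prod (chi q) (J2 j1 j3) (Dprime q),
     lin_prod (\<lambda>m. m) (Mset q j1 j2 j3) (gK - gA),
     lin_prod (\<lambda>m. m) (Mset q j2 j3 j1) (gK - gB),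
     lin_prod (\<lambda>m. m) (Mset q j1 j3 j2) (gK - gD),
     lin_prod (\<lambda>m. m) (Mset q j1 j3 j2) (gK - Dprime q),
     \<Omega> q - (cst (chi q j1 ^ 2 + chi q j2 ^ 2 + chi q j3 ^ 2) + gK * gK
             + cst (chi q j1 * chi q j2 * chi q j3) * gK - cst ((q + inverse q) ^ 2))}"

definition AWbar :: "complex \<Rightarrow> rat \<Rightarrow> rat \<Rightarrow> rat \<Rightarrow> (complex, aw_gen free set set) module" where
  "AWbar q j1 j2 j3 = alg_quot (AW3 q) (AW3_cls q ` awbar_rels q j1 j2 j3)"

definition AWbar_cls ::
    "complex \<Rightarrow> rat \<Rightarrow> rat \<Rightarrow> rat \<Rightarrow> aw_gen free \<Rightarrow> aw_gen free set set" where
  "AWbar_cls q j1 j2 j3 x = alg_cls (AW3 q) (AW3_cls q ` awbar_rels q j1 j2 j3) (AW3_cls q x)"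

text \<open>
  The elements determined by \<open>A = (q - 1/q)^2 A\<tilde> + q + 1/q\<close> and \<open>B = (q - 1/q)^2 B\<tilde> + q + 1/q\<close>.
\<close>

definition Atilde :: "complex \<Rightarrow> aw_gen free" where
  "Atilde q = cst (1 / (q - inverse q) ^ 2) * (gA - cst (q + inverse q))"

definition Btilde :: "complex \<Rightarrow> aw_gen free" where
  "Btilde q = cst (1 / (q - inverse q) ^ 2) * (gB - cst (q + inverse q))"

lemma Atilde_Btilde_eqs:
  assumes "q \<noteq> inverse q"
  shows "gA = cst ((q - inverse q) ^ 2) * Atilde q + cst (q + inverse q)"
    and "gB = cst ((q - inverse q) ^ 2) * Btilde q + cst (q + inverse q)"
proof -
  have "cst ((q - inverse q) ^ 2) * cst (1 / (q - inverse q) ^ 2) = (1 :: aw_gen free)"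
    using assms by (simp flip: cst_mult add: cst_1)
  then show "gA = cst ((q - inverse q) ^ 2) * Atilde q + cst (q + inverse q)"
    and "gB = cst ((q - inverse q) ^ 2) * Btilde q + cst (q + inverse q)"
    by (simp_all add: Atilde_def Btilde_def flip: mult.assoc)
qed

end

theory Submission
  imports Defs
begin

text \<open>
  Put \<open>\<delta> = q + 1/q\<close>, \<open>c = (q - 1/q)\<^sup>2\<close> and \<open>a = \<chi>\<^sub>1\<^sub>/\<^sub>2\<close>, and let \<open>U\<close>, \<open>V\<close> be the elements \<open>A\<tilde>\<close>, \<open>B\<tilde>\<close> of the
  quotient. The quadratic relations for \<open>A\<close>, \<open>B\<close> say \<open>U\<^sup>2 = \<delta>U\<close>, \<open>V\<^sup>2 = \<delta>V\<close>; those for \<open>K - A\<close>, \<open>K - B\<close>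
  exclude \<open>K = \<chi>\<^sub>3\<^sub>/\<^sub>2\<close> unless \<open>A = B = \<chi>\<^sub>1\<close>, so that the central element \<open>W = (K - a)/c\<close> satisfies
  \<open>WU = WV = \<delta>W\<close>. Multiplying two of the Askey-Wilson relations by \<open>U\<close> on both sides and eliminating
  \<open>UDU\<close> gives \<open>UVU = U + \<delta>W\<close>, and likewise \<open>VUV = V + \<delta>W\<close>. Then
  \<open>R = UV + VU - \<delta>(U + V) + \<delta>\<^sup>2 - 1 - W\<close> is annihilated by \<open>U\<close>, \<open>V\<close> and \<open>W\<close>, hence an eigenvector of \<open>D\<close>
  for an eigenvalue that the quadratic relation for \<open>D\<close> forbids, and \<open>R = 0\<close>. Therefore \<open>\<delta> - U\<close> and
  \<open>\<delta> - V\<close> satisfy the Temperley-Lieb relations and generate the quotient.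

  Conversely, the Temperley-Lieb algebra acts faithfully by pairs of a 2x2 matrix and a scalar,
  in which all relations of the quotient are identities between Laurent polynomials in \<open>q\<close>.
\<close>

section \<open>Quotients of the free algebra\<close>

lemma alg_quot_simps:
  "carrier (alg_quot R S) = carrier (R Quot (Idl\<^bsub>R\<^esub> S))"
  "mult (alg_quot R S) = mult (R Quot (Idl\<^bsub>R\<^esub> S))"
  "one (alg_quot R S) = one (R Quot (Idl\<^bsub>R\<^esub> S))"
  "zero (alg_quot R S) = zero (R Quot (Idl\<^bsub>R\<^esub> S))"
  "add (alg_quot R S) = add (R Quot (Idl\<^bsub>R\<^esub> S))"
  by (simp_all add: alg_quot_def ring.extend_def)

lemma ring_alg_quot:
  assumes "ring R" "S \<subseteq> carrier R"
  shows "ring (alg_quot R S)"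
proof -
  interpret ring R by fact
  interpret Q: ring "R Quot (Idl\<^bsub>R\<^esub> S)"
    using ideal.quotient_is_ring[OF genideal_ideal[OF assms(2)]] .
  have "abelian_group (alg_quot R S)"
  proof (rule abelian_groupI, unfold alg_quot_simps)
    show "\<exists>y\<in>carrier (R Quot (Idl\<^bsub>R\<^esub> S)). y \<oplus>\<^bsub>R Quot (Idl\<^bsub>R\<^esub> S)\<^esub> x = \<zero>\<^bsub>R Quot (Idl\<^bsub>R\<^esub> S)\<^esub>"
      if "x \<in> carrier (R Quot (Idl\<^bsub>R\<^esub> S))" for x
      using Q.l_neg[OF that] Q.a_inv_closed[OF that] by (rule bexI)
    show "x \<oplus>\<^bsub>R Quot (Idl\<^bsub>R\<^esub> S)\<^esub> y = y \<oplus>\<^bsub>R Quot (Idl\<^bsub>R\<^esub> S)\<^esub> x"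
      if "x \<in> carrier (R Quot (Idl\<^bsub>R\<^esub> S))" "y \<in> carrier (R Quot (Idl\<^bsub>R\<^esub> S))" for x y
      using that by (rule Q.a_comm)
  qed (simp_all add: Q.a_assoc)
  moreover have "Group.monoid (alg_quot R S)"
    by (rule monoidI) (simp_all add: alg_quot_simps Q.m_assoc)
  ultimately show ?thesis
    by (rule ringI) (simp_all add: alg_quot_simps Q.l_distr Q.r_distr)
qed

lemma ring_hom_ring_alg_cls:
  assumes "ring R" "S \<subseteq> carrier R"
  shows "ring_hom_ring R (alg_quot R S) (alg_cls R S)"
proof -
  interpret ring R by fact
  interpret h: ring_hom_ring R "R Quot (Idl\<^bsub>R\<^esub> S)" "(+>\<^bsub>R\<^esub>) (Idl\<^bsub>R\<^esub> S)"
    using ideal.rcos_ring_hom_ring[OF genideal_ideal[OF assms(2)]] .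
  show ?thesis
    using assms ring_alg_quot[OF assms] h.homh
    by (intro ring_hom_ringI2) (auto simp: ring_hom_def alg_quot_simps alg_cls_def)
qed

lemma carrier_alg_quot: "carrier (alg_quot R S) = alg_cls R S ` carrier R"
  by (auto simp: alg_quot_simps FactRing_simps alg_cls_def)

lemma alg_cls_eq_iff:
  assumes "ring R" "S \<subseteq> carrier R" "x \<in> carrier R" "y \<in> carrier R"
  shows "alg_cls R S x = alg_cls R S y \<longleftrightarrow> x \<ominus>\<^bsub>R\<^esub> y \<in> Idl\<^bsub>R\<^esub> S"
  using ring.quotient_eq_iff_same_a_r_cos[OF assms(1) ring.genideal_ideal[OF assms(1,2)] assms(3,4)]
  by (auto simp: alg_cls_def)

lemma free_alg_simps [simp]:
  "carrier free_alg = UNIV" "mult free_alg = (*)" "one free_alg = 1" "zero free_alg = 0"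
  "add free_alg = (+)" "smult free_alg = (\<lambda>c x. cst c * x)"
  by (simp_all add: free_alg_def)

lemma minus_free_alg [simp]: "x \<ominus>\<^bsub>free_alg\<^esub> y = x - y"
proof -
  interpret ring "free_alg :: (complex, 'a free) module" by (rule ring_free_alg)
  have "\<ominus>\<^bsub>free_alg\<^esub> y = - y"
    by (rule minus_equality) simp_all
  then show ?thesis by (simp add: a_minus_def)
qed

text \<open>Scalars act through the classes of the constants, so linearity of a map between such
  quotients reduces to multiplicativity and its values on constants.\<close>

lemma alg_quot_smult:
  fixes S :: "'g free set"
  assumes "X \<in> carrier (alg_quot free_alg S)"
  shows "c \<odot>\<^bsub>alg_quot free_alg S\<^esub> X = alg_cls free_alg S (cst c) \<otimes>\<^bsub>alg_quot free_alg S\<^esub> X"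
proof -
  interpret h: ring_hom_ring free_alg "alg_quot free_alg S" "alg_cls free_alg S"
    by (rule ring_hom_ring_alg_cls[OF ring_free_alg]) simp
  obtain x where "X = alg_cls free_alg S x" using assms by (auto simp: carrier_alg_quot)
  moreover have "c \<odot>\<^bsub>alg_quot free_alg S\<^esub> alg_cls free_alg S x = alg_cls free_alg S (cst c * x)"
    by (subst smult_alg_cls[OF ring_free_alg]) (simp_all add: algebra_simps)
  ultimately show ?thesis using h.hom_mult[of "cst c" x] by simp
qed

section \<open>The iterated quotient as a single quotient of the free algebra\<close>

lemma ring_hom_ring_AWbar_cls:
  "ring_hom_ring free_alg (AWbar q j1 j2 j3) (AWbar_cls q j1 j2 j3)"
proof -
  have h: "ring_hom_ring free_alg (AW3 q) (AW3_cls q)"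
    using ring_hom_ring_alg_cls[OF ring_free_alg, of "aw3_rels q"] by (simp add: AW3_def AW3_cls_def[abs_def])
  interpret h: ring_hom_ring free_alg "AW3 q" "AW3_cls q" by (rule h)
  have "AW3_cls q ` awbar_rels q j1 j2 j3 \<subseteq> carrier (AW3 q)"
    using h.hom_closed by auto
  from ring_hom_ring_alg_cls[OF h.S.ring_axioms this] have
    k: "ring_hom_ring (AW3 q) (AWbar q j1 j2 j3) (alg_cls (AW3 q) (AW3_cls q ` awbar_rels q j1 j2 j3))"
    by (simp add: AWbar_def)
  interpret k: ring_hom_ring "AW3 q" "AWbar q j1 j2 j3" "alg_cls (AW3 q) (AW3_cls q ` awbar_rels q j1 j2 j3)"
    by (rule k)
  show ?thesis
    using ring_hom_trans[OF h.homh k.homh] h.R.ring_axioms k.S.ring_axioms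
    by (intro ring_hom_ringI2) (simp_all add: comp_def AWbar_cls_def[abs_def])
qed

lemma carrier_AWbar: "carrier (AWbar q j1 j2 j3) = range (AWbar_cls q j1 j2 j3)"
  by (auto simp: AWbar_def AWbar_cls_def AW3_def AW3_cls_def carrier_alg_quot)

lemma AWbar_smult:
  assumes "X \<in> carrier (AWbar q j1 j2 j3)"
  shows "c \<odot>\<^bsub>AWbar q j1 j2 j3\<^esub> X = AWbar_cls q j1 j2 j3 (cst c) \<otimes>\<^bsub>AWbar q j1 j2 j3\<^esub> X"
proof -
  interpret h: ring_hom_ring free_alg "AW3 q" "AW3_cls q"
    using ring_hom_ring_alg_cls[OF ring_free_alg, of "aw3_rels q"] by (simp add: AW3_def AW3_cls_def[abs_def])
  interpret k: ring_hom_ring free_alg "AWbar q j1 j2 j3" "AWbar_cls q j1 j2 j3"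
    by (rule ring_hom_ring_AWbar_cls)
  have smult: "d \<odot>\<^bsub>AW3 q\<^esub> Y = AW3_cls q (cst d) \<otimes>\<^bsub>AW3 q\<^esub> Y" if "Y \<in> carrier (AW3 q)" for d Y
    using alg_quot_smult[of Y "aw3_rels q" d] that by (simp add: AW3_def AW3_cls_def)
  obtain x where x: "X = AWbar_cls q j1 j2 j3 x" using assms by (auto simp: carrier_AWbar)
  have "c \<odot>\<^bsub>AWbar q j1 j2 j3\<^esub> X
      = alg_cls (AW3 q) (AW3_cls q ` awbar_rels q j1 j2 j3) (c \<odot>\<^bsub>AW3 q\<^esub> AW3_cls q x)"
    unfolding x AWbar_def AWbar_cls_def
    by (rule smult_alg_cls) (use h.hom_closed h.S.ring_axioms in
        \<open>auto simp: smult h.S.r_distr h.S.m_assoc\<close>)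
  also have "\<dots> = AWbar_cls q j1 j2 j3 (cst c * x)"
    using h.hom_mult[of "cst c" x] by (simp add: AWbar_cls_def smult)
  finally show ?thesis using k.hom_mult[of "cst c" x] x by simp
qed

lemma (in ring_hom_ring) ideal_image:
  assumes "ideal J R" "h ` carrier R = carrier S"
  shows "ideal (h ` J) S"
proof (rule idealI)
  interpret J: ideal J R by fact
  show "subgroup (h ` J) (add_monoid S)"
  proof (rule group.subgroupI[OF S.add.is_group])
    show "h ` J \<subseteq> carrier (add_monoid S)" using J.Icarr by auto
    show "h ` J \<noteq> {}" using J.zero_closed by blast
    fix a b assume "a \<in> h ` J" "b \<in> h ` J"
    then obtain x y where "a = h x" "b = h y" "x \<in> J" "y \<in> J" by blast
    then show "a \<otimes>\<^bsub>add_monoid S\<^esub> b \<in> h ` J"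
      using J.Icarr J.a_closed by (intro image_eqI[of _ _ "x \<oplus> y"]) simp_all
  next
    fix a assume "a \<in> h ` J"
    then obtain x where x: "a = h x" "x \<in> J" by blast
    then have "inv\<^bsub>add_monoid S\<^esub> a = h (\<ominus> x)"
      using J.Icarr by (simp flip: a_inv_def)
    then show "inv\<^bsub>add_monoid S\<^esub> a \<in> h ` J"
      using x(2) J.a_inv_closed by blast
  qed
next
  interpret J: ideal J R by fact
  fix a x assume ax: "a \<in> h ` J" "x \<in> carrier S"
  then obtain b y where b: "a = h b" "x = h y" "b \<in> J" "y \<in> carrier R" using assms(2) by blast
  show "x \<otimes>\<^bsub>S\<^esub> a \<in> h ` J" 
    using b J.Icarr J.I_l_closed by (intro image_eqI[of _ _ "y \<otimes> b"]) simp_all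
  show "a \<otimes>\<^bsub>S\<^esub> x \<in> h ` J" 
    using b J.Icarr J.I_r_closed by (intro image_eqI[of _ _ "b \<otimes> y"]) simp_all
qed (rule S.ring_axioms)

lemma AWbar_rels_zero:
  assumes "x \<in> aw3_rels q \<union> awbar_rels q j1 j2 j3"
  shows "AWbar_cls q j1 j2 j3 x = \<zero>\<^bsub>AWbar q j1 j2 j3\<^esub>"
proof -
  interpret h: ring_hom_ring free_alg "AW3 q" "AW3_cls q"
    using ring_hom_ring_alg_cls[OF ring_free_alg, of "aw3_rels q"] by (simp add: AW3_def AW3_cls_def[abs_def])
  let ?S = "AW3_cls q ` awbar_rels q j1 j2 j3"
  have S: "?S \<subseteq> carrier (AW3 q)" using h.hom_closed by auto
  interpret k: ring_hom_ring "AW3 q" "AWbar q j1 j2 j3" "alg_cls (AW3 q) ?S"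
    unfolding AWbar_def by (rule ring_hom_ring_alg_cls[OF h.S.ring_axioms S])
  have "alg_cls (AW3 q) ?S (AW3_cls q x) = alg_cls (AW3 q) ?S \<zero>\<^bsub>AW3 q\<^esub>"
  proof (cases "x \<in> aw3_rels q")
    case True
    have "x \<in> Idl\<^bsub>free_alg\<^esub> aw3_rels q"
      using ring.genideal_self[OF ring_free_alg, of "aw3_rels q"] True by auto
    then have "AW3_cls q x = AW3_cls q 0"
      unfolding AW3_cls_def by (subst alg_cls_eq_iff[OF ring_free_alg]) auto
    then show ?thesis using h.hom_zero by simp
  next
    case False
    then have "AW3_cls q x \<in> Idl\<^bsub>AW3 q\<^esub> ?S"
      using h.S.genideal_self[OF S] assms by auto
    then show ?thesis
      using h.hom_closed by (subst alg_cls_eq_iff[OF h.S.ring_axioms S]) (auto simp: h.S.minus_eq)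
  qed
  then show ?thesis using k.hom_zero by (simp add: AWbar_cls_def)
qed

text \<open>Together with \<open>AWbar_rels_zero\<close> this identifies the kernel. The image of
  \<open>J\<close> in the first quotient is an ideal containing the second set of relators, so
  \<open>x\<close> agrees there with some \<open>y\<close> in \<open>J\<close>; the difference
  \<open>x - y\<close> comes from the first set of relators and lies in \<open>J\<close>
  too.\<close>

lemma AWbar_kernel_minimal:
  assumes J: "ideal J free_alg" "aw3_rels q \<union> awbar_rels q j1 j2 j3 \<subseteq> J"
    and x: "AWbar_cls q j1 j2 j3 x = \<zero>\<^bsub>AWbar q j1 j2 j3\<^esub>"
  shows "x \<in> J"
proof -
  interpret h: ring_hom_ring free_alg "AW3 q" "AW3_cls q"
    using ring_hom_ring_alg_cls[OF ring_free_alg, of "aw3_rels q"] by (simp add: AW3_def AW3_cls_def[abs_def])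
  interpret J: ideal J free_alg by fact
  let ?S = "AW3_cls q ` awbar_rels q j1 j2 j3"
  have S: "?S \<subseteq> carrier (AW3 q)" using h.hom_closed by auto
  interpret k: ring_hom_ring "AW3 q" "AWbar q j1 j2 j3" "alg_cls (AW3 q) ?S"
    unfolding AWbar_def by (rule ring_hom_ring_alg_cls[OF h.S.ring_axioms S])
  have "alg_cls (AW3 q) ?S (AW3_cls q x) = alg_cls (AW3 q) ?S \<zero>\<^bsub>AW3 q\<^esub>"
    using x k.hom_zero by (simp add: AWbar_cls_def)
  then have "AW3_cls q x \<in> Idl\<^bsub>AW3 q\<^esub> ?S"
    using iffD1[OF alg_cls_eq_iff[OF h.S.ring_axioms S, of "AW3_cls q x" "\<zero>\<^bsub>AW3 q\<^esub>"]] h.hom_closed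
    by (simp add: h.S.minus_eq)
  moreover have "ideal (AW3_cls q ` J) (AW3 q)"
    by (rule h.ideal_image[OF J(1)]) (simp add: AW3_def AW3_cls_def[abs_def] carrier_alg_quot)
  ultimately have "AW3_cls q x \<in> AW3_cls q ` J"
    using h.S.genideal_minimal[of "AW3_cls q ` J" ?S] J(2) by blast
  then obtain y where y: "y \<in> J" "AW3_cls q x = AW3_cls q y" by blast
  then have "x - y \<in> Idl\<^bsub>free_alg\<^esub> aw3_rels q"
    using alg_cls_eq_iff[OF ring_free_alg, of "aw3_rels q" x y] by (simp add: AW3_cls_def)
  then have "x - y \<in> J"
    using ring.genideal_minimal[OF ring_free_alg J(1), of "aw3_rels q"] J(2) by blast
  from J.a_closed[OF this y(1)] show ?thesis by simp
qed

section \<open>Homomorphisms out of the free algebra and the maps they induce on quotients\<close>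

locale free_hom =
  fixes s :: "complex \<Rightarrow> 'r::ring_1" and \<phi> :: "'g free \<Rightarrow> 'r"
  assumes add: "\<phi> (x + y) = \<phi> x + \<phi> y"
    and mult: "\<phi> (x * y) = \<phi> x * \<phi> y"
    and cst: "\<phi> (cst c) = s c"
begin

sublocale additive \<phi> by standard (rule add)

lemma one: "\<phi> 1 = s 1" using cst[of 1] by (simp add: cst_1)

lemmas simps = add mult cst minus diff zero one

lemma kernel_ideal: "ideal {x. \<phi> x = 0} free_alg"
proof (rule idealI[OF ring_free_alg])
  interpret R: ring "free_alg :: (complex, 'g free) module" by (rule ring_free_alg)
  have inv: "inv\<^bsub>add_monoid free_alg\<^esub> x = - x" for x :: "'g free"
    using minus_free_alg[of 0 x] by (simp add: a_minus_def a_inv_def del: minus_free_alg)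
  show "subgroup {x. \<phi> x = 0} (add_monoid free_alg)"
  proof (rule group.subgroupI[OF R.add.is_group])
    show "inv\<^bsub>add_monoid free_alg\<^esub> x \<in> {x. \<phi> x = 0}" if "x \<in> {x. \<phi> x = 0}" for x
      using that unfolding inv by (simp add: simps)
  qed (auto simp: simps intro: exI[of _ 0])
qed (auto simp: simps)

end

text \<open>By \<open>ker\<close>, \<open>\<phi>\<close> descends to a well-defined injective map,
  and by \<open>surj\<close> this map is onto. It is linear because scalars act through constants,
  which \<open>\<phi>\<close> preserves.\<close>

lemma alg_iso_factor:
  assumes \<pi>: "ring_hom_ring free_alg Q \<pi>" "carrier Q = range \<pi>"
      "\<And>c X. X \<in> carrier Q \<Longrightarrow> c \<odot>\<^bsub>Q\<^esub> X = \<pi> (cst c) \<otimes>\<^bsub>Q\<^esub> X"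
    and \<tau>: "ring_hom_ring free_alg T \<tau>" "carrier T = range \<tau>"
      "\<And>c X. X \<in> carrier T \<Longrightarrow> c \<odot>\<^bsub>T\<^esub> X = \<tau> (cst c) \<otimes>\<^bsub>T\<^esub> X"
    and \<phi>: "free_hom cst \<phi>"
    and ker: "\<And>x. \<pi> x = \<zero>\<^bsub>Q\<^esub> \<longleftrightarrow> \<tau> (\<phi> x) = \<zero>\<^bsub>T\<^esub>"
    and surj: "\<And>y. \<exists>x. \<tau> (\<phi> x) = \<tau> y"
  shows "\<exists>\<Phi>\<in>alg_iso Q T. \<forall>x. \<Phi> (\<pi> x) = \<tau> (\<phi> x)"
proof -
  interpret p: ring_hom_ring free_alg Q \<pi> by fact
  interpret t: ring_hom_ring free_alg T \<tau> by fact
  interpret f: free_hom cst \<phi> by fact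
  have hom_diff: "h x = h y \<longleftrightarrow> h (x - y) = \<zero>\<^bsub>W\<^esub>"
    if "ring_hom_ring free_alg W h" for W :: "(complex, 'z) module" and h and x y :: "'k free"
  proof -
    interpret h: ring_hom_ring free_alg W h by fact
    have "h x = h (x - y) \<oplus>\<^bsub>W\<^esub> h y"
      using h.hom_add[of "x - y" y] by simp
    then show ?thesis
      using h.hom_closed h.S.add.right_cancel[of "h (x - y)" "h y" "\<zero>\<^bsub>W\<^esub>"] by auto
  qed
  have eq: "\<pi> x = \<pi> y \<longleftrightarrow> \<tau> (\<phi> x) = \<tau> (\<phi> y)" for x y
    unfolding hom_diff[OF \<pi>(1)] hom_diff[OF \<tau>(1)] f.diff[symmetric] by (rule ker)
  \<comment> \<open>A representative is chosen arbitrarily; by \<open>eq\<close> the value does not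
    depend on the choice.\<close>
  define \<Phi> where "\<Phi> X = \<tau> (\<phi> (SOME x. \<pi> x = X))" for X
  have \<Phi>: "\<Phi> (\<pi> x) = \<tau> (\<phi> x)" for x
    unfolding \<Phi>_def eq[symmetric] by (rule someI) simp
  have "\<Phi> \<in> ring_hom Q T"
  proof (rule ring_hom_memI)
    show "\<Phi> \<one>\<^bsub>Q\<^esub> = \<one>\<^bsub>T\<^esub>"
      using \<Phi>[of 1] f.cst[of 1] p.hom_one t.hom_one by (simp add: cst_1)
    fix X Y assume "X \<in> carrier Q" "Y \<in> carrier Q"
    then obtain x y where xy: "X = \<pi> x" "Y = \<pi> y" by (auto simp: \<pi>(2))
    show "\<Phi> X \<in> carrier T" by (simp add: xy \<Phi> \<tau>(2))
    have "\<Phi> (X \<otimes>\<^bsub>Q\<^esub> Y) = \<Phi> (\<pi> (x * y))"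
      using p.hom_mult[of x y] by (simp add: xy)
    then show "\<Phi> (X \<otimes>\<^bsub>Q\<^esub> Y) = \<Phi> X \<otimes>\<^bsub>T\<^esub> \<Phi> Y"
      using t.hom_mult[of "\<phi> x" "\<phi> y"] by (simp add: xy \<Phi> f.simps)
    have "\<Phi> (X \<oplus>\<^bsub>Q\<^esub> Y) = \<Phi> (\<pi> (x + y))"
      using p.hom_add[of x y] by (simp add: xy)
    then show "\<Phi> (X \<oplus>\<^bsub>Q\<^esub> Y) = \<Phi> X \<oplus>\<^bsub>T\<^esub> \<Phi> Y"
      using t.hom_add[of "\<phi> x" "\<phi> y"] by (simp add: xy \<Phi> f.simps)
  qed
  moreover have "bij_betw \<Phi> (carrier Q) (carrier T)"
    unfolding bij_betw_def inj_on_def \<pi>(2) \<tau>(2)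
  proof (intro conjI ballI impI equalityI subsetI)
    show "X = Y" if "X \<in> range \<pi>" "Y \<in> range \<pi>" "\<Phi> X = \<Phi> Y" for X Y
      using that eq by (auto simp: \<Phi>)
    show "Y \<in> range \<tau>" if "Y \<in> \<Phi> ` range \<pi>" for Y
      using that by (auto simp: \<Phi>)
    show "Y \<in> \<Phi> ` range \<pi>" if "Y \<in> range \<tau>" for Y
    proof -
      from that obtain y where y: "Y = \<tau> y" by blast
      obtain x where "\<tau> (\<phi> x) = \<tau> y" using surj by blast
      then have "Y = \<Phi> (\<pi> x)" by (simp add: y \<Phi>)
      then show ?thesis by blast
    qed
  qed
  moreover have "\<Phi> (c \<odot>\<^bsub>Q\<^esub> X) = c \<odot>\<^bsub>T\<^esub> \<Phi> X" if "X \<in> carrier Q" for c X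
  proof -
    from that obtain x where x: "X = \<pi> x" by (auto simp: \<pi>(2))
    have "\<Phi> (c \<odot>\<^bsub>Q\<^esub> X) = \<Phi> (\<pi> (cst c * x))"
      using p.hom_mult[of "cst c" x] \<pi>(3)[OF that, of c] by (simp add: x)
    then show ?thesis
      using t.hom_mult[of "cst c" "\<phi> x"] \<tau>(3)[of "\<tau> (\<phi> x)" c] by (simp add: x \<Phi> f.simps \<tau>(2))
  qed
  ultimately show ?thesis using \<Phi> by (auto simp: alg_iso_def ring_iso_def)
qed

section \<open>Evaluation of the free algebra\<close>

lemma cst_left_commute: "x * (cst c * y) = cst c * (x * y)" for x y :: "'g free"
  by (simp only: mult.assoc[symmetric] cst_central[of c x])

lemma cst_0: "cst 0 = (0 :: 'g free)"
  by (simp add: cst_def)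

lemma cst_diff: "cst (c - d) = (cst c - cst d :: 'g free)"
  by (simp add: cst_def single_diff)

lemma cst_merge: "cst c * cst d = (cst (c * d) :: 'g free)" "cst c * (cst d * x) = cst (c * d) * (x :: 'g free)"
  by (simp_all add: cst_mult mult.assoc)

lemma gen_cst: "gen g * cst c = cst c * gen g" "gen g * (cst c * x) = cst c * (gen g * x)"
  by (rule cst_central[symmetric], rule cst_left_commute)

lemma free_alg_induct [case_names cst gen_mult add]:
  assumes cst: "\<And>c. P (cst c)"
    and gen_mult: "\<And>g x. P x \<Longrightarrow> P (gen g * x)"
    and add: "\<And>x y. P x \<Longrightarrow> P y \<Longrightarrow> P (x + y)"
  shows "P (x :: 'g free)"
proof (induction x rule: update_induct)
  case const
  show ?case using cst[of 0] by (simp add: cst_def)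
next
  case (update f a b)
  \<comment> \<open>Updating at a key outside the support adds a monomial; monomials are then built
    letter by letter from a constant.\<close>
  have "Poly_Mapping.update a b f = f + Poly_Mapping.single a b"
    using update(1) by (intro poly_mapping_eqI)
      (auto simp: lookup_update lookup_add lookup_single when_def in_keys_iff)
  moreover have "P (Poly_Mapping.single (Word w) b)" for w
  proof (induction w)
    case Nil
    show ?case using cst[of b] by (simp add: cst_def zero_fmon_def)
  next
    case (Cons g w)
    then show ?case using gen_mult[of "Poly_Mapping.single (Word w) b" g]
      by (simp add: gen_def mult_single)
  qed
  ultimately show ?case using update(3) by (cases a) (simp add: add)
qed

fun word_prod :: "('g \<Rightarrow> 'r::monoid_mult) \<Rightarrow> 'g fmon \<Rightarrow> 'r" where
  "word_prod g (Word w) = prod_list (map g w)"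

lemma word_prod_plus: "word_prod g (v + w) = word_prod g v * word_prod g w"
  by (cases v; cases w) simp

text \<open>The homomorphism provided by the universal property of the free algebra, with
  \<open>s\<close> as the structure map of the target.\<close>

definition free_eval :: "(complex \<Rightarrow> 'r::ring_1) \<Rightarrow> ('g \<Rightarrow> 'r) \<Rightarrow> 'g free \<Rightarrow> 'r" where
  "free_eval s g f = (\<Sum>w\<in>Poly_Mapping.keys f. s (Poly_Mapping.lookup f w) * word_prod g w)"

locale central_scalars =
  fixes s :: "complex \<Rightarrow> 'r::ring_1"
  assumes s_add: "s (c + d) = s c + s d"
    and s_mult: "s (c * d) = s c * s d"
    and s_one: "s 1 = 1"
    and s_central: "s c * x = x * s c"
begin

lemma s_zero: "s 0 = 0" using s_add[of 0 0] by simp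

lemma free_eval_add: "free_eval s g (x + y) = free_eval s g x + free_eval s g y"
proof -
  have sub: "free_eval s g f = (\<Sum>w\<in>Poly_Mapping.keys x \<union> Poly_Mapping.keys y. s (Poly_Mapping.lookup f w) * word_prod g w)"
    if "Poly_Mapping.keys f \<subseteq> Poly_Mapping.keys x \<union> Poly_Mapping.keys y" for f
    unfolding free_eval_def
    by (rule sum.mono_neutral_left) (use that in \<open>auto simp: in_keys_iff s_zero\<close>)
  show ?thesis
    using keys_add[of x y] by (simp add: sub lookup_add s_add algebra_simps sum.distrib)
qed

lemma free_eval_single: "free_eval s g (Poly_Mapping.single w c) = s c * word_prod g w"
  by (cases "c = 0") (simp_all add: free_eval_def s_zero)

lemma free_eval_cst: "free_eval s g (cst c) = s c"
  by (simp add: cst_def free_eval_single zero_fmon_def)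

lemma free_eval_gen: "free_eval s g (gen h) = g h"
  by (simp add: gen_def free_eval_single s_one)

text \<open>Checked on monomials, where the image of the coefficient has to move past the image of
  the generator; centrality of the scalars allows this.\<close>

lemma free_eval_gen_mult: "free_eval s g (gen h * x) = g h * free_eval s g x"
proof (induction x rule: update_induct)
  case const
  show ?case by (simp add: free_eval_def)
next
  case (update f a b)
  have "Poly_Mapping.update a b f = f + Poly_Mapping.single a b"
    using update(1) by (intro poly_mapping_eqI)
      (auto simp: lookup_update lookup_add lookup_single when_def in_keys_iff)
  moreover have "free_eval s g (gen h * Poly_Mapping.single a b) = g h * free_eval s g (Poly_Mapping.single a b)"
    using s_central[of b "g h"]
    by (simp add: gen_def mult_single free_eval_single word_prod_plus flip: mult.assoc)
  ultimately show ?case using update(3) by (simp add: algebra_simps free_eval_add)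
qed

lemma free_eval_cst_mult: "free_eval s g (cst c * x) = s c * free_eval s g x"
proof (induction x rule: free_alg_induct)
  case (cst d)
  then show ?case by (simp add: free_eval_cst s_mult flip: cst_mult)
next
  case (gen_mult h x)
  have "free_eval s g (cst c * (gen h * x)) = (g h * s c) * free_eval s g x"
    by (simp only: gen_cst(2)[symmetric] free_eval_gen_mult gen_mult mult.assoc)
  also have "g h * s c = s c * g h" by (rule s_central[symmetric])
  finally show ?case by (simp only: free_eval_gen_mult mult.assoc)
qed (simp add: free_eval_add algebra_simps)

lemma free_eval_mult: "free_eval s g (x * y) = free_eval s g x * free_eval s g y"
  by (induction x rule: free_alg_induct)
    (simp_all add: free_eval_cst free_eval_cst_mult free_eval_gen_mult free_eval_add mult.assoc distrib_right)

lemma free_hom_free_eval: "free_hom s (free_eval s g)"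
  by standard (simp_all add: free_eval_add free_eval_mult free_eval_cst)

end

lemma central_scalars_cst: "central_scalars (cst :: complex \<Rightarrow> 'g free)"
  by standard (rule cst_add cst_mult cst_1 cst_central)+

section \<open>A faithful representation of the Temperley-Lieb algebra\<close>

text \<open>\<open>TLM a b c d e\<close> is the pair of the matrix with rows \<open>(a, b)\<close>, \<open>(c, d)\<close> and the scalar \<open>e\<close>.\<close>

datatype tlm = TLM complex complex complex complex complex

instantiation tlm :: ring_1
begin

definition "0 = TLM 0 0 0 0 0"
definition "1 = TLM 1 0 0 1 1"
fun plus_tlm where "TLM a b c d e + TLM a' b' c' d' e' = TLM (a + a') (b + b') (c + c') (d + d') (e + e')"
fun uminus_tlm where "- TLM a b c d e = TLM (- a) (- b) (- c) (- d) (- e)"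
fun minus_tlm where "TLM a b c d e - TLM a' b' c' d' e' = TLM (a - a') (b - b') (c - c') (d - d') (e - e')"
fun times_tlm where "TLM a b c d e * TLM a' b' c' d' e' =
  TLM (a * a' + b * c') (a * b' + b * d') (c * a' + d * c') (c * b' + d * d') (e * e')"

instance
proof
  fix x y z :: tlm
  show "x + y + z = x + (y + z)" "x * y * z = x * (y * z)" "(x + y) * z = x * z + y * z"
    "x * (y + z) = x * y + x * z"
    by (cases x; cases y; cases z; simp add: algebra_simps)+
  show "x + y = y + x" "x - y = x + - y"
    by (cases x; cases y; simp add: algebra_simps)+
  show "0 + x = x" "- x + x = 0" "1 * x = x" "x * 1 = x"
    by (cases x; simp add: zero_tlm_def one_tlm_def)+
  show "(0::tlm) \<noteq> 1" by (simp add: zero_tlm_def one_tlm_def)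
qed

end

definition tlm_scal :: "complex \<Rightarrow> tlm" where "tlm_scal c = TLM c 0 0 c c"

lemma central_scalars_tlm: "central_scalars tlm_scal"
proof
  fix c and x :: tlm
  show "tlm_scal c * x = x * tlm_scal c" by (cases x) (simp add: tlm_scal_def)
qed (simp_all add: tlm_scal_def one_tlm_def)

text \<open>The matrix part is left multiplication on the left ideal generated by
  \<open>\<sigma>1\<close>, in the basis \<open>\<sigma>1\<close>,
  \<open>\<sigma>2 * \<sigma>1\<close>. The scalar part is the character that kills both
  generators.\<close>

definition tl_repr :: "complex \<Rightarrow> tl_gen free \<Rightarrow> tlm" where
  "tl_repr q = free_eval tlm_scal
     (\<lambda>g. case g of S1 \<Rightarrow> TLM (q + inverse q) 1 0 0 0 | S2 \<Rightarrow> TLM 0 0 1 (q + inverse q) 0)"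

lemma free_hom_tl_repr: "free_hom tlm_scal (tl_repr q)"
  unfolding tl_repr_def by (rule central_scalars.free_hom_free_eval[OF central_scalars_tlm])

lemma tl_repr_gen:
  "tl_repr q \<sigma>1 = TLM (q + inverse q) 1 0 0 0" "tl_repr q \<sigma>2 = TLM 0 0 1 (q + inverse q) 0"
  by (simp_all add: tl_repr_def central_scalars.free_eval_gen[OF central_scalars_tlm])

lemma tl_repr_rels: "r \<in> tl_rels q \<Longrightarrow> tl_repr q r = 0"
  unfolding tl_rels_def
  by (auto simp: free_hom.simps[OF free_hom_tl_repr] tl_repr_gen tlm_scal_def zero_tlm_def)

section \<open>Congruences modulo an ideal of the free algebra, and Temperley-Lieb normal
  forms\<close>

locale free_ideal = ideal N "free_alg :: (complex, 'g free) module" for N :: "'g free set"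
begin

lemma N_zero: "0 \<in> N" and N_add: "x \<in> N \<Longrightarrow> y \<in> N \<Longrightarrow> x + y \<in> N"
  and N_lmult: "x \<in> N \<Longrightarrow> y * x \<in> N" and N_rmult: "x \<in> N \<Longrightarrow> x * y \<in> N"
  using additive_subgroup.zero_closed[OF additive_subgroup_axioms]
    additive_subgroup.a_closed[OF additive_subgroup_axioms, of x y] I_l_closed[of x y] I_r_closed[of x y]
  by auto

lemma N_diff: "x \<in> N \<Longrightarrow> y \<in> N \<Longrightarrow> x - y \<in> N"
  using N_add[of x "- y"] N_lmult[of y "- 1"] by simp

lemmas N_closed = N_zero N_add N_diff N_lmult N_rmult

lemma N_scale_cancel:
  assumes "cst c * x \<in> N" "c \<noteq> 0"
  shows "x \<in> N"
proof -
  have "cst (inverse c) * (cst c * x) = x"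
    using assms(2) by (simp add: cst_1 flip: cst_mult mult.assoc)
  then show ?thesis using N_lmult[OF assms(1), of "cst (inverse c)"] by simp
qed

lemma lin_prod_eigen:
  assumes "finite S" "x * z - cst t * z \<in> N"
  shows "lin_prod f S x * z - cst (\<Prod>i\<in>S. t - f i) * z \<in> N"
  using assms(1)
proof induction
  case empty
  then show ?case by (simp add: lin_prod_empty cst_1 N_zero)
next
  case (insert i S)
  let ?p = "\<Prod>i\<in>S. t - f i"
  \<comment> \<open>The first summand is the induction hypothesis times the new factor; the second
    replaces \<open>x\<close> in the new factor by its eigenvalue \<open>t\<close>.\<close>
  have "lin_prod f (insert i S) x * z - cst (\<Prod>i\<in>insert i S. t - f i) * z
    = (x - cst (f i)) * (lin_prod f S x * z - cst ?p * z) + cst ?p * (x * z - cst t * z)"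
    using insert(1,2) cst_central[of ?p x] cst_central[of ?p "cst (f i)"]
    by (simp add: lin_prod_insert cst_diff cst_mult left_diff_distrib right_diff_distrib mult.assoc
      cst_left_commute[of x] cst_left_commute[of "cst (f i)"] cst_left_commute[of "cst t"])
  then show ?case using insert(3) assms(2) by (simp add: N_closed)
qed

text \<open>Modulo \<open>N\<close> the product kills \<open>z\<close>, yet it also multiplies
  \<open>z\<close> by the nonzero number \<open>\<Prod>i\<in>S. t - f i\<close>. Each annihilating
  polynomial thereby excludes eigenvalues outside its set of roots.\<close>

lemma lin_prod_eigen_zero:
  assumes "finite S" "x * z - cst t * z \<in> N" "lin_prod f S x \<in> N" "\<And>i. i \<in> S \<Longrightarrow> t \<noteq> f i"
  shows "z \<in> N"
proof (rule N_scale_cancel)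
  show "cst (\<Prod>i\<in>S. t - f i) * z \<in> N"
    using N_diff[OF N_rmult[OF assms(3), of z] lin_prod_eigen[OF assms(1,2), of f]] by simp
  show "(\<Prod>i\<in>S. t - f i) \<noteq> 0" using assms(1,4) by simp
qed

end

text \<open>The five reduced words of the Temperley-Lieb algebra on three strands; their number
  equals the dimension 4 + 1 of the target of \<open>tl_repr\<close>.\<close>

definition tl_nf :: "complex \<Rightarrow> complex \<Rightarrow> complex \<Rightarrow> complex \<Rightarrow> complex \<Rightarrow> tl_gen free" where
  "tl_nf a b c d e = cst a + cst b * \<sigma>1 + cst c * \<sigma>2 + cst d * (\<sigma>1 * \<sigma>2) + cst e * (\<sigma>2 * \<sigma>1)"

lemma tl_nf_exists:
  assumes "free_ideal N" "tl_rels q \<subseteq> N"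
  shows "\<exists>a b c d e. x - tl_nf a b c d e \<in> N"
proof (induction x rule: free_alg_induct)
  interpret free_ideal N by fact
  define \<delta> where "\<delta> = q + inverse q"
  have r: "\<sigma>1 * \<sigma>1 - cst \<delta> * \<sigma>1 \<in> N" "\<sigma>2 * \<sigma>2 - cst \<delta> * \<sigma>2 \<in> N"
    "\<sigma>1 * \<sigma>2 * \<sigma>1 - \<sigma>1 \<in> N" "\<sigma>2 * \<sigma>1 * \<sigma>2 - \<sigma>2 \<in> N"
    using assms(2) by (auto simp: tl_rels_def \<delta>_def)
  {
    case (cst c)
    have "cst c - tl_nf c 0 0 0 0 \<in> N" by (simp add: tl_nf_def cst_0 N_zero)
    then show ?case by blast
  next
    case (gen_mult g x)
    then obtain a b c d e where x: "x - tl_nf a b c d e \<in> N" by blast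
    show ?case
    proof (cases g)
      case S1
      \<comment> \<open>The new coefficients come from reducing \<open>\<sigma>1\<close> times each
        reduced word; the last three summands are the relators used, with their
        coefficients.\<close>
      have eq: "gen g * x - tl_nf 0 (a + \<delta> * b + e) 0 (c + \<delta> * d) 0 
        = gen g * (x - tl_nf a b c d e) + cst b * (\<sigma>1 * \<sigma>1 - cst \<delta> * \<sigma>1)
          + cst d * ((\<sigma>1 * \<sigma>1 - cst \<delta> * \<sigma>1) * \<sigma>2) + cst e * (\<sigma>1 * \<sigma>2 * \<sigma>1 - \<sigma>1)"
        by (simp add: S1 tl_nf_def algebra_simps gen_cst cst_add cst_0 cst_merge)
      have "gen g * x - tl_nf 0 (a + \<delta> * b + e) 0 (c + \<delta> * d) 0 \<in> N"
        unfolding eq by (intro N_add N_lmult N_rmult x r)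
      then show ?thesis by blast
    next
      case S2
      have eq: "gen g * x - tl_nf 0 0 (a + \<delta> * c + d) 0 (b + \<delta> * e)
        = gen g * (x - tl_nf a b c d e) + cst c * (\<sigma>2 * \<sigma>2 - cst \<delta> * \<sigma>2)
          + cst e * ((\<sigma>2 * \<sigma>2 - cst \<delta> * \<sigma>2) * \<sigma>1) + cst d * (\<sigma>2 * \<sigma>1 * \<sigma>2 - \<sigma>2)"
        by (simp add: S2 tl_nf_def algebra_simps gen_cst cst_add cst_0 cst_merge)
      have "gen g * x - tl_nf 0 0 (a + \<delta> * c + d) 0 (b + \<delta> * e) \<in> N"
        unfolding eq by (intro N_add N_lmult N_rmult x r)
      then show ?thesis by blast
    qed
  next
    case (add x y)
    then obtain a b c d e a' b' c' d' e' where
      xy: "x - tl_nf a b c d e \<in> N" "y - tl_nf a' b' c' d' e' \<in> N" by blast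
    have "x + y - tl_nf (a + a') (b + b') (c + c') (d + d') (e + e')
      = (x - tl_nf a b c d e) + (y - tl_nf a' b' c' d' e')"
      by (simp add: tl_nf_def cst_add algebra_simps)
    then have "x + y - tl_nf (a + a') (b + b') (c + c') (d + d') (e + e') \<in> N"
      using xy by (simp only: N_add)
    then show ?case by blast
  }
qed

lemma tl_repr_nf:
  "tl_repr q (tl_nf a b c d e) =
    TLM (a + (q + inverse q) * b + d) (b + (q + inverse q) * d) (c + (q + inverse q) * e)
      (a + (q + inverse q) * c + e) a"
  by (simp add: tl_nf_def free_hom.simps[OF free_hom_tl_repr] tl_repr_gen tlm_scal_def algebra_simps)

text \<open>The normal form of \<open>x\<close> also lies in the kernel. Reading off matrix entries
  gives \<open>a = 0\<close> and one 2x2 system each for \<open>b\<close>, \<open>d\<close> and for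
  \<open>c\<close>, \<open>e\<close>, both with determinant \<open>\<delta>\<^sup>2 - 1\<close> up
  to sign.\<close>

lemma tl_repr_kernel:
  assumes q: "(q + inverse q)\<^sup>2 \<noteq> 1" and x: "tl_repr q x = 0"
  shows "x \<in> Idl\<^bsub>free_alg\<^esub> (tl_rels q)"
proof -
  let ?N = "Idl\<^bsub>free_alg\<^esub> (tl_rels q)"
  interpret free_ideal ?N
    unfolding free_ideal_def by (rule ring.genideal_ideal[OF ring_free_alg]) simp
  interpret h: free_hom tlm_scal "tl_repr q" by (rule free_hom_tl_repr)
  have "tl_rels q \<subseteq> ?N" by (rule ring.genideal_self[OF ring_free_alg]) simp
  then obtain a b c d e where nf: "x - tl_nf a b c d e \<in> ?N"
    using tl_nf_exists[OF free_ideal_axioms] by blast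
  have "?N \<subseteq> {x. tl_repr q x = 0}"
    by (rule ring.genideal_minimal[OF ring_free_alg h.kernel_ideal]) (use tl_repr_rels in auto)
  then have 0: "tl_repr q (tl_nf a b c d e) = 0"
    using nf x by (auto simp: h.simps)
  define \<delta> where "\<delta> = q + inverse q"
  have "a = 0" "\<delta> * b + d = 0" "b + \<delta> * d = 0" "c + \<delta> * e = 0" "\<delta> * c + e = 0"
    using 0 by (auto simp: tl_repr_nf zero_tlm_def \<delta>_def)
  moreover have "(\<delta>\<^sup>2 - 1) * b = \<delta> * (\<delta> * b + d) - (b + \<delta> * d)"
    "(\<delta>\<^sup>2 - 1) * e = \<delta> * (c + \<delta> * e) - (\<delta> * c + e)"
    by (simp_all add: algebra_simps power2_eq_square)
  ultimately have "a = 0" "b = 0" "c = 0" "d = 0" "e = 0"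
    using q by (auto simp: \<delta>_def)
  then have "tl_nf a b c d e = 0" by (simp add: tl_nf_def cst_0)
  then show ?thesis using nf by simp
qed

section \<open>The Temperley-Lieb relations in the Askey-Wilson quotient\<close>

lemma cst_uminus: "cst (- c) = (- cst c :: 'g free)"
  using cst_diff[of 0 c] by (simp add: cst_0)

lemmas cst_simps = cst_add cst_diff cst_uminus cst_merge cst_0 cst_1

context free_ideal begin

lemma N_cong: "x \<in> N \<Longrightarrow> y = x \<Longrightarrow> y \<in> N" by simp

text \<open>Next to \<open>U\<close> the element \<open>X\<close> acts as the number
  \<open>e\<close> from either side. Between two factors \<open>U\<close> both products
  \<open>E * X\<close> and \<open>X * E\<close> thus become \<open>e\<close> times \<open>E\<close>,
  and a q-commutator contributes only through the sum of its weights.\<close>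

lemma sandwich:
  assumes r: "Y + cst s * (E * X) + cst t * (X * E) - k \<in> N"
    and X: "X * U - cst e * U \<in> N" "U * X - cst e * U \<in> N"
  shows "U * Y * U + cst ((s + t) * e) * (U * E * U) - U * k * U \<in> N"
proof -
  note c = cst_central[of _ U, symmetric] cst_left_commute[of U]
    cst_central[of _ E, symmetric] cst_left_commute[of E]
  have "U * Y * U + cst ((s + t) * e) * (U * E * U) - U * k * U
    = U * (Y + cst s * (E * X) + cst t * (X * E) - k) * U
      - cst s * (U * E * (X * U - cst e * U)) - cst t * ((U * X - cst e * U) * (E * U))"
    by (simp add: algebra_simps c cst_simps)
  moreover have "\<dots> \<in> N"
    by (intro N_diff N_lmult N_rmult r X)
  ultimately show ?thesis by simp
qed

end

text \<open>
  \<open>2a\<^sup>2/\<delta> - \<delta>\<close> is the eigenvalue of \<open>D\<close> on the element \<open>R\<close> of the introduction, and \<open>b - \<delta>\<close> that of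
  \<open>K - A\<close> where \<open>K = \<chi>\<^sub>3\<^sub>/\<^sub>2\<close> and \<open>A = \<chi>\<^sub>0\<close>.
\<close>

locale aw_half = free_ideal N for N :: "'g free set" +
  fixes A B D K U V W :: "'g free" and q p a b c d e \<delta> :: complex
    and f :: "'i \<Rightarrow> complex" and S :: "'i set" and m :: "'j \<Rightarrow> complex" and M M' :: "'j set"
  assumes qp: "q * p = 1"
    and scalars: "\<delta> = q + p" "a = q\<^sup>2 + p\<^sup>2" "b = q ^ 4 + p ^ 4" "c = (q - p)\<^sup>2" "d = q\<^sup>2 - p\<^sup>2" "e = q ^ 3 + p ^ 3"
    and nonzero: "\<delta> \<noteq> 0" "a \<noteq> 0" "c \<noteq> 0" "d \<noteq> 0"
    and A: "A = cst c * U + cst \<delta>" and B: "B = cst c * V + cst \<delta>"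
    and K_eq: "K = cst c * W + cst a"
    and KA: "K * A - A * K \<in> N" and KB: "K * B - B * K \<in> N"
    and A2: "(A - cst \<delta>) * (A - cst e) \<in> N" and B2: "(B - cst \<delta>) * (B - cst e) \<in> N"
    and K2: "(K - cst b) * (K - cst a) \<in> N"
    and fin: "finite S" "finite M" "finite M'"
    and fD: "lin_prod f S D \<in> N" "\<And>i. i \<in> S \<Longrightarrow> 2 * a * a / \<delta> - \<delta> \<noteq> f i"
    and mKA: "lin_prod m M (K - A) \<in> N" "\<And>i. i \<in> M \<Longrightarrow> b - \<delta> \<noteq> m i"
    and mKB: "lin_prod m M' (K - B) \<in> N" "\<And>i. i \<in> M' \<Longrightarrow> b - \<delta> \<noteq> m i"
    and rA: "A + cst (1 / d) * (cst q * B * D - cst p * D * B) - cst (1 / \<delta>) * (cst (a * a) + cst a * K) \<in> N"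
    and rB: "B + cst (1 / d) * (cst q * D * A - cst p * A * D) - cst (1 / \<delta>) * (cst (a * a) + cst a * K) \<in> N"
    and rD: "D + cst (1 / d) * (cst q * A * B - cst p * B * A) - cst (1 / \<delta>) * (cst (a * a) + cst a * K) \<in> N"
begin

lemma scalar_eqs: "e = \<delta> + c * \<delta>" "\<delta> * \<delta> = a + 2" "c = a - 2" "(1 / d) * (q - p) * e = a - 1"
proof -
  show 1: "e = \<delta> + c * \<delta>" "\<delta> * \<delta> = a + 2" "c = a - 2"
  proof -
    \<comment> \<open>With \<open>q\<close> and \<open>p\<close> as independent variables each
      identity holds up to an explicit multiple of \<open>q * p - 1\<close>, which then
      vanishes.\<close>
    have "e = \<delta> + c * \<delta> + (q + p) * (q * p - 1)" "\<delta> * \<delta> = a + 2 + 2 * (q * p - 1)"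
      "c = a - 2 - 2 * (q * p - 1)"
      unfolding scalars by (simp_all add: algebra_simps power2_eq_square power3_eq_cube)
    then show "e = \<delta> + c * \<delta>" "\<delta> * \<delta> = a + 2" "c = a - 2"
      unfolding qp by simp_all
  qed
  have "(q - p) * e = (a - 1) * d - (q\<^sup>2 - p\<^sup>2) * (q * p - 1)"
    unfolding scalars by (simp add: algebra_simps power2_eq_square power3_eq_cube)
  then have "(q - p) * e = (a - 1) * d" unfolding qp by simp
  then show "(1 / d) * (q - p) * e = a - 1" using nonzero by (simp add: field_simps)
qed

text \<open>Since \<open>e = \<delta> + c * \<delta>\<close>, the affine substitution carries the
  roots \<open>\<delta>\<close> and \<open>e\<close> of \<open>X\<close> to the roots 0 and
  \<open>\<delta>\<close> of \<open>Y\<close>.\<close>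

lemma quadratic_aux:
  assumes X: "X = cst c * Y + cst \<delta>" and X2: "(X - cst \<delta>) * (X - cst e) \<in> N"
  shows "Y * Y - cst \<delta> * Y \<in> N"
proof (rule N_scale_cancel)
  have "cst (c * c) * (Y * Y - cst \<delta> * Y) = (X - cst \<delta>) * (X - cst e)"
    using cst_central[of _ Y, symmetric] cst_left_commute[of Y]
    by (simp add: X scalar_eqs(1) algebra_simps cst_simps)
  then show "cst (c * c) * (Y * Y - cst \<delta> * Y) \<in> N" using X2 by simp
qed (use nonzero in simp)

text \<open>The element \<open>?Z\<close> lies in the joint eigenspace \<open>K = b\<close>,
  \<open>X = \<delta>\<close>, so \<open>K - X\<close> acts on it by \<open>b - \<delta>\<close>,
  which is not a root of the product over \<open>L\<close>. Hence \<open>?Z\<close> vanishes modulo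
  \<open>N\<close>, and it is \<open>c * c\<close> times
  \<open>W * Y - \<delta> * W\<close>.\<close>

lemma central_aux:
  assumes X: "X = cst c * Y + cst \<delta>" and X2: "(X - cst \<delta>) * (X - cst e) \<in> N"
    and KX: "K * X - X * K \<in> N"
    and L: "lin_prod m L (K - X) \<in> N" "finite L" "\<And>i. i \<in> L \<Longrightarrow> b - \<delta> \<noteq> m i"
  shows "W * Y - cst \<delta> * W \<in> N" "Y * W - cst \<delta> * W \<in> N"
proof -
  note comm = cst_central[of _ Y, symmetric] cst_left_commute[of Y]
    cst_central[of _ W, symmetric] cst_left_commute[of W]
    cst_central[of _ X, symmetric] cst_left_commute[of X]
    cst_central[of _ K, symmetric] cst_left_commute[of K]
  let ?Z = "(K - cst a) * (X - cst e)"
  have 1: "K * ?Z - cst b * ?Z \<in> N"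
    using N_rmult[OF K2, of "X - cst e"] by (simp add: algebra_simps)
  have "X * ?Z - cst \<delta> * ?Z = (K - cst a) * ((X - cst \<delta>) * (X - cst e)) - (K * X - X * K) * (X - cst e)"
    by (simp add: algebra_simps comm cst_simps)
  then have 2: "X * ?Z - cst \<delta> * ?Z \<in> N"
    by (simp only:) (intro N_diff N_lmult[OF X2] N_rmult[OF KX])
  have "(K - X) * ?Z - cst (b - \<delta>) * ?Z \<in> N"
    using N_diff[OF 1 2] by (simp add: algebra_simps cst_diff)
  from lin_prod_eigen_zero[OF L(2) this L(1,3)] have "?Z \<in> N" .
  moreover have "?Z = cst (c * c) * (W * Y - cst \<delta> * W)"
    unfolding K_eq X scalar_eqs(1) by (simp add: algebra_simps comm cst_simps)
  ultimately show WY: "W * Y - cst \<delta> * W \<in> N"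
    using N_scale_cancel[of "c * c"] nonzero by simp
  \<comment> \<open>The commutator of \<open>W\<close> and \<open>Y\<close> is a rescaled commutator
    of \<open>K\<close> and \<open>X\<close>; this transfers the relation to the other order of the
    factors.\<close>
  have "K * X - X * K = cst (c * c) * (W * Y - Y * W)"
    unfolding K_eq X by (simp add: algebra_simps comm cst_simps)
  then have "W * Y - Y * W \<in> N"
    using KX N_scale_cancel[of "c * c"] nonzero by simp
  from N_diff[OF WY this] show "Y * W - cst \<delta> * W \<in> N" by simp
qed

lemma UU: "U * U - cst \<delta> * U \<in> N" and VV: "V * V - cst \<delta> * V \<in> N"
  by (rule quadratic_aux[OF A A2] quadratic_aux[OF B B2])+

lemma WU: "W * U - cst \<delta> * W \<in> N" "U * W - cst \<delta> * W \<in> N"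
  using central_aux[OF A A2 KA mKA(1) fin(2) mKA(2)] by blast+

lemma WV: "W * V - cst \<delta> * W \<in> N" "V * W - cst \<delta> * W \<in> N"
  using central_aux[OF B B2 KB mKB(1) fin(3) mKB(2)] by blast+

text \<open>Sandwiching both relations between factors \<open>Y\<close> gives two linear equations
  for \<open>Y * X' * Y\<close> and \<open>Y * D * Y\<close>. The weights \<open>s\<close>,
  \<open>t\<close> are kept general so that both orders of \<open>A\<close> and \<open>B\<close> are
  covered: exchanging them exchanges the weights and keeps \<open>s + t\<close>.\<close>

lemma braid_aux:
  fixes X X' Y Y' :: "'g free"
  assumes X: "X = cst c * Y + cst \<delta>" and X': "X' = cst c * Y' + cst \<delta>"
    and st: "s + t = (1 / d) * (q - p)"
    and r: "X' + cst s * (D * X) + cst t * (X * D) - cst (1 / \<delta>) * (cst (a * a) + cst a * K) \<in> N"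
    and r': "D + cst s * (X * X') + cst t * (X' * X) - cst (1 / \<delta>) * (cst (a * a) + cst a * K) \<in> N"
    and YY: "Y * Y - cst \<delta> * Y \<in> N"
    and WY: "W * Y - cst \<delta> * W \<in> N" "Y * W - cst \<delta> * W \<in> N"
  shows "Y * Y' * Y - Y - cst \<delta> * W \<in> N"
proof -
  note comm = cst_central[of _ Y, symmetric] cst_left_commute[of Y]
    cst_central[of _ Y', symmetric] cst_left_commute[of Y']
    cst_central[of _ W, symmetric] cst_left_commute[of W]
    cst_central[of _ D, symmetric] cst_left_commute[of D]
    cst_central[of _ K, symmetric] cst_left_commute[of K]
  let ?k = "cst (1 / \<delta>) * (cst (a * a) + cst a * K)"
  have "X * Y - cst e * Y = cst c * (Y * Y - cst \<delta> * Y)" "Y * X - cst e * Y = cst c * (Y * Y - cst \<delta> * Y)"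
    unfolding X scalar_eqs(1) by (simp_all add: algebra_simps comm cst_simps)
  then have XY: "X * Y - cst e * Y \<in> N" "Y * X - cst e * Y \<in> N"
    using N_lmult[OF YY] by simp_all
  have "(s + t) * e = a - 1" using st scalar_eqs(4) by simp
  then have 1: "Y * X' * Y + cst (a - 1) * (Y * D * Y) - Y * ?k * Y \<in> N"
    using sandwich[OF r XY] by simp
  have "(t + s) * e = a - 1" using st scalar_eqs(4) by (simp add: add.commute)
  moreover have "D + cst t * (X' * X) + cst s * (X * X') - ?k \<in> N"
    using r' by (simp add: add_ac)
  ultimately have 2: "Y * D * Y + cst (a - 1) * (Y * X' * Y) - Y * ?k * Y \<in> N"
    using sandwich[OF _ XY, of D t X' s ?k] by simp
  have k: "Y * ?k * Y = cst (a / \<delta>) * (cst a * (Y * Y) + cst a * (Y * Y) + cst c * (Y * W * Y))"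
    unfolding K_eq by (simp add: algebra_simps comm cst_simps)
  have "a - 1 = 1 + c" "a = 1 + 1 + c" unfolding scalar_eqs(3) by simp_all
  then have ca: "cst (a - 1) = 1 + (cst c :: 'g free)" "cst a = 1 + 1 + (cst c :: 'g free)"
    by (simp_all only: cst_add cst_1)
  \<comment> \<open>Elimination of \<open>T\<close>: the remaining coefficients are
    \<open>1 - (a - 1)\<^sup>2 = - c * a\<close> for \<open>P\<close> and \<open>c\<close> for
    \<open>k'\<close>, because \<open>c = a - 2\<close>.\<close>
  have comb: "P + cst (a - 1) * T - k' - cst (a - 1) * (T + cst (a - 1) * P - k') = cst (- c) * (cst a * P - k')"
    for P T k' :: "'g free"
    unfolding ca by (simp add: algebra_simps cst_simps) (simp add: mult_2 distrib_left)
  have "cst (- c) * (cst a * (Y * X' * Y) - Y * ?k * Y) \<in> N"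
    using N_diff[OF 1 N_lmult[OF 2, of "cst (a - 1)"]] unfolding comb .
  then have "cst a * (Y * X' * Y) - Y * ?k * Y \<in> N"
    using N_scale_cancel nonzero by simp
  moreover have "cst a * (Y * X' * Y) - Y * ?k * Y
      = cst (a / \<delta>) * (cst \<delta> * (Y * X' * Y) - (cst a * (Y * Y) + cst a * (Y * Y) + cst c * (Y * W * Y)))"
    unfolding k right_diff_distrib cst_merge using nonzero by simp
  ultimately have 3: "cst \<delta> * (Y * X' * Y) - (cst a * (Y * Y) + cst a * (Y * Y) + cst c * (Y * W * Y)) \<in> N"
    using N_scale_cancel[of "a / \<delta>"] nonzero by simp
  have 4: "Y * W * Y - cst (\<delta> * \<delta>) * W \<in> N"
    by (rule N_cong[OF N_add[OF N_rmult[OF WY(2), of Y] N_lmult[OF WY(1), of "cst \<delta>"]]])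
      (simp add: algebra_simps comm cst_simps)
  \<comment> \<open>After \<open>X'\<close> is replaced by \<open>c * Y' + \<delta>\<close>, the
    terms in \<open>Y * Y\<close> combine with coefficient
    \<open>2 * a - \<delta> * \<delta> = c\<close>. This leaves a common factor
    \<open>c * \<delta>\<close> to cancel.\<close>
  have "\<delta> * \<delta> = c + 4" "a + a = c + c + 4"
    unfolding scalar_eqs(2,3) by simp_all
  then have \<delta>2: "cst (\<delta> * \<delta>) * y = cst c * y + cst 4 * y" "cst a * y + cst a * y = cst c * y + cst c * y + cst 4 * y"
    for y :: "'g free"
    by (metis cst_add distrib_right)+
  have "cst (c * \<delta>) * (Y * Y' * Y - Y - cst \<delta> * W)
      = (cst \<delta> * (Y * X' * Y) - (cst a * (Y * Y) + cst a * (Y * Y) + cst c * (Y * W * Y)))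
        + cst c * (Y * Y - cst \<delta> * Y) + cst c * (Y * W * Y - cst (\<delta> * \<delta>) * W)"
    unfolding X' \<delta>2(2) by (simp add: algebra_simps comm cst_simps) (simp add: \<delta>2(1) algebra_simps)
  moreover have "\<dots> \<in> N"
    by (intro N_add N_lmult 3 YY 4)
  ultimately show ?thesis
    using N_scale_cancel[of "c * \<delta>"] nonzero by simp
qed

lemma UVU: "U * V * U - U - cst \<delta> * W \<in> N"
proof (rule braid_aux[OF A B _ _ _ UU WU])
  show "B + cst (q / d) * (D * A) + cst (- p / d) * (A * D) - cst (1 / \<delta>) * (cst (a * a) + cst a * K) \<in> N"
    using rB by (simp add: algebra_simps cst_simps mult.assoc)
  show "D + cst (q / d) * (A * B) + cst (- p / d) * (B * A) - cst (1 / \<delta>) * (cst (a * a) + cst a * K) \<in> N"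
    using rD by (simp add: algebra_simps cst_simps mult.assoc)
qed (simp add: diff_divide_distrib)

lemma VUV: "V * U * V - V - cst \<delta> * W \<in> N"
proof (rule braid_aux[OF B A _ _ _ VV WV])
  show "A + cst (- p / d) * (D * B) + cst (q / d) * (B * D) - cst (1 / \<delta>) * (cst (a * a) + cst a * K) \<in> N"
    using rA by (simp add: algebra_simps cst_simps mult.assoc)
  show "D + cst (- p / d) * (B * A) + cst (q / d) * (A * B) - cst (1 / \<delta>) * (cst (a * a) + cst a * K) \<in> N"
    using rD by (simp add: algebra_simps cst_simps mult.assoc)
qed (simp add: diff_divide_distrib)

lemma W_eq: "U * V + V * U - cst \<delta> * (U + V) + cst (\<delta> * \<delta> - 1) - W \<in> N" (is "?R \<in> N")
proof -
  note comm = cst_central[of _ U, symmetric] cst_left_commute[of U]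
    cst_central[of _ V, symmetric] cst_left_commute[of V]
    cst_central[of _ W, symmetric] cst_left_commute[of W]
    cst_central[of _ A, symmetric] cst_left_commute[of A]
    cst_central[of _ B, symmetric] cst_left_commute[of B]
  define R where "R = ?R"
  have "U * R = (U * U - cst \<delta> * U) * V + (U * V * U - U - cst \<delta> * W) - cst \<delta> * (U * U - cst \<delta> * U)
      - (U * W - cst \<delta> * W)"
    unfolding R_def by (simp add: algebra_simps comm cst_simps)
  also have "\<dots> \<in> N" by (intro N_add N_diff N_lmult N_rmult UU UVU WU)
  finally have UR: "U * R \<in> N" .
  have "V * R = (V * V - cst \<delta> * V) * U + (V * U * V - V - cst \<delta> * W) - cst \<delta> * (V * V - cst \<delta> * V)
      - (V * W - cst \<delta> * W)"
    unfolding R_def by (simp add: algebra_simps comm cst_simps)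
  also have "\<dots> \<in> N" by (intro N_add N_diff N_lmult N_rmult VV VUV WV)
  finally have VR: "V * R \<in> N" .
  \<comment> \<open>\<open>W\<close> kills \<open>R\<close> because \<open>\<delta> * W\<close> is
    congruent to \<open>W * U\<close> and \<open>U\<close> kills \<open>R\<close>.\<close>
  have "cst \<delta> * (W * R) = W * (U * R) - (W * U - cst \<delta> * W) * R"
    by (simp add: algebra_simps)
  also have "\<dots> \<in> N" by (intro N_diff N_lmult N_rmult UR WU)
  finally have WR: "W * R \<in> N" using N_scale_cancel nonzero by blast
  have AR: "A * R - cst \<delta> * R \<in> N" and BR: "B * R - cst \<delta> * R \<in> N" and KR: "K * R - cst a * R \<in> N"
    using N_lmult[OF UR, of "cst c"] N_lmult[OF VR, of "cst c"] N_lmult[OF WR, of "cst c"]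
    by (simp_all add: A B K_eq algebra_simps)
  let ?t = "2 * a * a / \<delta> - \<delta>"
  \<comment> \<open>This is the value of \<open>D\<close> that the third relation yields at
    \<open>A = B = \<delta>\<close>, \<open>K = a\<close>; it simplifies by
    \<open>(q - p) * \<delta> = d\<close>.\<close>
  have t: "?t = a * a / \<delta> + a * a / \<delta> - (q / d) * \<delta> * \<delta> + (p / d) * \<delta> * \<delta>"
  proof -
    have "(q - p) * \<delta> = d" unfolding scalars by (simp add: algebra_simps power2_eq_square)
    then have "(q - p) * \<delta> * \<delta> / d = \<delta>" using nonzero by simp
    then show ?thesis by (simp add: algebra_simps diff_divide_distrib)
  qed
  have "D * R - cst ?t * R
    = (D + cst (1 / d) * (cst q * A * B - cst p * B * A) - cst (1 / \<delta>) * (cst (a * a) + cst a * K)) * R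
      - cst (q / d) * (A * (B * R - cst \<delta> * R) + cst \<delta> * (A * R - cst \<delta> * R))
      + cst (p / d) * (B * (A * R - cst \<delta> * R) + cst \<delta> * (B * R - cst \<delta> * R))
      + cst (a / \<delta>) * (K * R - cst a * R)"
    unfolding t cst_add cst_diff by (simp add: algebra_simps comm cst_simps)
  also have "\<dots> \<in> N" by (intro N_add N_diff N_lmult AR BR KR N_rmult[OF rD])
  finally have "R \<in> N" using lin_prod_eigen_zero[OF fin(1) _ fD] by blast
  then show ?thesis by (simp add: R_def)
qed

lemma TL_relations:
  defines "X \<equiv> cst \<delta> - U" and "Y \<equiv> cst \<delta> - V"
  shows "X * X - cst \<delta> * X \<in> N" "Y * Y - cst \<delta> * Y \<in> N" "X * Y * X - X \<in> N" "Y * X * Y - Y \<in> N"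
    and "K - (cst a + cst c * (X * Y + Y * X - cst \<delta> * (X + Y) + cst (\<delta> * \<delta> - 1))) \<in> N"
proof -
  note comm = cst_central[of _ U, symmetric] cst_left_commute[of U]
    cst_central[of _ V, symmetric] cst_left_commute[of V]
    cst_central[of _ W, symmetric] cst_left_commute[of W]
  note simps = X_def Y_def algebra_simps comm cst_simps
  show "X * X - cst \<delta> * X \<in> N" "Y * Y - cst \<delta> * Y \<in> N"
    by (rule N_cong[OF UU]; simp add: simps) (rule N_cong[OF VV]; simp add: simps)
  \<comment> \<open>Adding \<open>\<delta>\<close> times the relation for \<open>W\<close> cancels
    the term \<open>\<delta> * W\<close> left over from \<open>UVU\<close>.\<close>
  show "X * Y * X - X \<in> N"
    by (rule N_cong[OF N_add[OF N_lmult[OF W_eq] N_diff[OF N_lmult[OF UU, of "cst \<delta>"] UVU]], of _ "cst \<delta>"])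
      (simp add: simps)
  show "Y * X * Y - Y \<in> N"
    by (rule N_cong[OF N_add[OF N_lmult[OF W_eq] N_diff[OF N_lmult[OF VV, of "cst \<delta>"] VUV]], of _ "cst \<delta>"])
      (simp add: simps)
  \<comment> \<open>The expression for \<open>W\<close> in \<open>W_eq\<close> is invariant under
    replacing \<open>U\<close>, \<open>V\<close> by \<open>\<delta> - U\<close>,
    \<open>\<delta> - V\<close>.\<close>
  show "K - (cst a + cst c * (X * Y + Y * X - cst \<delta> * (X + Y) + cst (\<delta> * \<delta> - 1))) \<in> N"
    by (rule N_cong[OF N_lmult[OF W_eq, of "cst (- c)"]]) (simp add: K_eq simps)
qed

end

section \<open>Spin one half\<close>

lemma J2_values:
  "J2 (1/2) (1/2) = {0, 1}" "J2 0 (1/2) = {1/2}" "J2 1 (1/2) = {1/2, 3/2}"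
proof -
  have J2: "J2 j k = (\<lambda>n. \<bar>j - k\<bar> + of_nat n) ` {n. \<bar>j - k\<bar> + of_nat n \<le> j + k}" for j k
    by (auto simp: J2_def)
  have 1: "{n. of_nat n \<le> (1::rat)} = {0, 1}"
    using of_nat_le_iff[where ?'a = rat, of _ 1] by (auto simp: le_Suc_eq)
  have 0: "{n. of_nat n \<le> (0::rat)} = {0}"
    using of_nat_le_iff[where ?'a = rat, of _ 0] by auto
  show "J2 (1/2) (1/2) = {0, 1}" "J2 0 (1/2) = {1/2}" "J2 1 (1/2) = {1/2, 3/2}"
    using 0 1 by (simp_all add: J2 le_diff_eq[symmetric] del: of_nat_le_iff of_nat_le_1_iff)
qed

lemma J3_half: "J3 (1/2) (1/2) (1/2) = {3/2, 1/2}"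
  by (auto simp: J3_def J2_values)

text \<open>The two values with total spin 1/2 are listed first: where \<open>K\<close> equals
  \<open>\<chi>\<close> of spin 1/2, their factors form the quadratic polynomial of the element
  subtracted from \<open>K\<close>.\<close>

lemma Mset_half: "Mset q (1/2) (1/2) (1/2) = {chi q (1/2) - chi q 0, chi q (1/2) - chi q 1, chi q (3/2) - chi q 1}"
proof -
  have "{chi q l - chi q j |l. l \<in> S} = (\<lambda>l. chi q l - chi q j) ` S" for j and S :: "rat set"
    by auto
  then show ?thesis by (simp add: Mset_def J2_values insert_commute)
qed

lemma chi_values:
  "chi q 0 = q + inverse q" "chi q (1/2) = q\<^sup>2 + (inverse q)\<^sup>2"
  "chi q 1 = q ^ 3 + inverse q ^ 3" "chi q (3/2) = q ^ 4 + inverse q ^ 4"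
  by (simp_all add: chi_def power_int_def power_inverse)

section \<open>Consequences of \<open>q\<close> not being a root of unity\<close>

locale not_root_of_unity =
  fixes q :: complex
  assumes q_nonzero: "q \<noteq> 0" and q_power: "\<And>n::nat. n > 0 \<Longrightarrow> q ^ n \<noteq> 1"
begin

abbreviation "p \<equiv> inverse q"
abbreviation "\<delta> \<equiv> q + inverse q"
abbreviation "c \<equiv> (q - inverse q)\<^sup>2"
abbreviation "a \<equiv> chi q (1/2)"

lemma chi_eqs:
  "a = \<delta>\<^sup>2 - 2" "c = \<delta>\<^sup>2 - 4" "chi q 0 = \<delta>" "chi q 1 = \<delta> + c * \<delta>" "chi q (3/2) = a + c * (\<delta>\<^sup>2 - 1)"
  using q_nonzero by (simp_all add: chi_values field_simps eval_nat_numeral)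

text \<open>Each quantity, with \<open>q - p\<close> in place of \<open>c\<close>, divides some
  \<open>q ^ n - 1\<close> up to a power of \<open>q\<close>. The exponent and the cofactor are
  supplied case by case; the last two quantities are, up to \<open>q\<^sup>2\<close>, the tenth and
  the fifth cyclotomic polynomial.\<close>

lemma nonzero: "\<delta> \<noteq> 0" "c \<noteq> 0" "a \<noteq> 0" "q\<^sup>2 - p\<^sup>2 \<noteq> 0" 
  "\<delta>\<^sup>2 - 1 \<noteq> 0" "\<delta>\<^sup>2 - \<delta> - 1 \<noteq> 0" "\<delta>\<^sup>2 + \<delta> - 1 \<noteq> 0"
proof -
  have *: "x \<noteq> 0" if "q ^ n - 1 = y * x" "n > 0" for x y n
    using that q_power[of n] by auto
  show "\<delta> \<noteq> 0" by (rule *[of 4 "q * (q\<^sup>2 - 1)"]) (use q_nonzero in \<open>simp_all add: field_simps eval_nat_numeral\<close>)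
  have "q - p \<noteq> 0" by (rule *[of 2 q]) (use q_nonzero in \<open>simp_all add: field_simps eval_nat_numeral\<close>)
  then show "c \<noteq> 0" by simp
  show "a \<noteq> 0" by (rule *[of 8 "q\<^sup>2 * (q ^ 4 - 1)"]) (use q_nonzero in \<open>simp_all add: chi_values field_simps eval_nat_numeral\<close>)
  show "q\<^sup>2 - p\<^sup>2 \<noteq> 0" by (rule *[of 4 "q\<^sup>2"]) (use q_nonzero in \<open>simp_all add: field_simps eval_nat_numeral\<close>)
  show "\<delta>\<^sup>2 - 1 \<noteq> 0" by (rule *[of 6 "q\<^sup>2 * (q\<^sup>2 - 1)"]) (use q_nonzero in \<open>simp_all add: field_simps eval_nat_numeral\<close>)
  show "\<delta>\<^sup>2 - \<delta> - 1 \<noteq> 0" by (rule *[of 10 "q\<^sup>2 * (q + 1) * (q ^ 5 - 1)"])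
      (use q_nonzero in \<open>simp_all add: field_simps eval_nat_numeral\<close>)
  show "\<delta>\<^sup>2 + \<delta> - 1 \<noteq> 0" by (rule *[of 5 "q\<^sup>2 * (q - 1)"])
      (use q_nonzero in \<open>simp_all add: field_simps eval_nat_numeral\<close>)
qed

lemma chi_0_1: "chi q 0 \<noteq> chi q 1" and chi_half: "a \<noteq> chi q (3/2)"
  using nonzero by (simp_all add: chi_eqs(3-5))

text \<open>As products range over sets, distinctness is what yields three separate factors for
  \<open>Mset\<close>.\<close>

lemma Mset_distinct:
  "a - chi q 0 \<noteq> a - chi q 1" "a - chi q 0 \<noteq> chi q (3/2) - chi q 1" "a - chi q 1 \<noteq> chi q (3/2) - chi q 1"
proof -
  have "(chi q (3/2) - chi q 1) - (a - chi q 0) = c * (\<delta>\<^sup>2 - \<delta> - 1)"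
    unfolding chi_eqs(3-5) by (simp add: algebra_simps)
  then show "a - chi q 0 \<noteq> chi q (3/2) - chi q 1" using nonzero by auto
qed (use chi_0_1 chi_half in auto)

text \<open>Coincidence with either of the values sharing a term would force two equal
  \<open>\<chi>\<close>. The remaining difference is
  \<open>c * (\<delta>\<^sup>2 + \<delta> - 1)\<close>, whose second factor vanishes only at
  primitive fifth roots of unity.\<close>

lemma not_in_Mset:
  assumes "m \<in> Mset q (1/2) (1/2) (1/2)"
  shows "chi q (3/2) - chi q 0 \<noteq> m"
proof -
  have "(chi q (3/2) - chi q 0) - (a - chi q 1) = c * (\<delta>\<^sup>2 + \<delta> - 1)"
    unfolding chi_eqs(3-5) by (simp add: algebra_simps)
  then have "chi q (3/2) - chi q 0 \<noteq> a - chi q 1" using nonzero by auto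
  then show ?thesis
    using assms chi_0_1 chi_half by (auto simp: Mset_half)
qed

text \<open>Multiplied by \<open>\<delta>\<close>, the differences from the two roots factor as
  \<open>2 * c * (\<delta>\<^sup>2 - 1)\<close> and \<open>a * c\<close>.\<close>

lemma not_in_J2:
  assumes "j \<in> J2 (1/2) (1/2)"
  shows "2 * a * a / \<delta> - \<delta> \<noteq> chi q j"
proof -
  have "2 * (x\<^sup>2 - 2) * (x\<^sup>2 - 2) - x * x - x * x = 2 * ((x\<^sup>2 - 4) * (x\<^sup>2 - 1))"
    "2 * (x\<^sup>2 - 2) * (x\<^sup>2 - 2) - x * x - (x + (x\<^sup>2 - 4) * x) * x = (x\<^sup>2 - 2) * (x\<^sup>2 - 4)" for x :: complex
    by (simp_all add: algebra_simps power2_eq_square)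
  from this[of \<delta>] have "2 * a * a - \<delta> * \<delta> - chi q 0 * \<delta> = 2 * (c * (\<delta>\<^sup>2 - 1))"
    "2 * a * a - \<delta> * \<delta> - chi q 1 * \<delta> = a * c"
    unfolding chi_eqs(1-4) by blast+
  moreover have "(y / z - z - x) * z = y - z * z - x * z" if "z \<noteq> 0" for x y z :: complex
    using that by (simp add: left_diff_distrib)
  note this[OF nonzero(1)]
  ultimately have "(2 * a * a / \<delta> - \<delta> - chi q 0) * \<delta> = 2 * (c * (\<delta>\<^sup>2 - 1))"
    "(2 * a * a / \<delta> - \<delta> - chi q 1) * \<delta> = a * c" by metis+
  then have "2 * a * a / \<delta> - \<delta> - chi q 0 \<noteq> 0" "2 * a * a / \<delta> - \<delta> - chi q 1 \<noteq> 0"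
    using nonzero by (metis mult_eq_0_iff zero_neq_numeral)+
  then show ?thesis using assms by (auto simp: J2_values)
qed

end

lemma lin_prod_J2: "lin_prod (chi q) (J2 (1/2) (1/2)) x = (x - cst (chi q 0)) * (x - cst (chi q 1))"
  by (simp add: J2_values lin_prod_insert lin_prod_empty)

lemma lin_prod_J3:
  "lin_prod (chi q) (J3 (1/2) (1/2) (1/2)) x = (x - cst (chi q (3/2))) * (x - cst (chi q (1/2)))"
  by (simp add: J3_half lin_prod_insert lin_prod_empty)

lemma (in not_root_of_unity) lin_prod_Mset:
  "lin_prod (\<lambda>m. m) (Mset q (1/2) (1/2) (1/2)) x
    = (x - cst (a - chi q 0)) * ((x - cst (a - chi q 1)) * (x - cst (chi q (3/2) - chi q 1)))"
  using Mset_distinct by (simp add: Mset_half lin_prod_insert lin_prod_empty)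

section \<open>The map to the Temperley-Lieb algebra\<close>

context not_root_of_unity
begin

text \<open>\<open>tlK\<close> is \<open>\<chi>\<^sub>1\<^sub>/\<^sub>2 + (\<chi>\<^sub>3\<^sub>/\<^sub>2 - \<chi>\<^sub>1\<^sub>/\<^sub>2)P\<close> for the Jones-Wenzl projector \<open>P\<close>; \<open>tlD\<close> solves the third relation.\<close>

definition "tlA = cst (chi q 1) - cst c * \<sigma>1"
definition "tlB = cst (chi q 1) - cst c * \<sigma>2"
definition "tlK = cst a + cst c * (\<sigma>1 * \<sigma>2 + \<sigma>2 * \<sigma>1 - cst \<delta> * (\<sigma>1 + \<sigma>2) + cst (\<delta> * \<delta> - 1))"
definition "tlD = cst (1 / \<delta>) * (cst (a * a) + cst a * tlK)
  - cst (1 / (q powi 2 - q powi -2)) * qcomm q tlA tlB"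

text \<open>This map and \<open>tl_to_aw\<close> are defined between the free algebras.
  Compatibility with the relators is checked afterwards, for this map by matrices and for
  \<open>tl_to_aw\<close> by \<open>TL_relations\<close>.\<close>

definition aw_to_tl :: "aw_gen free \<Rightarrow> tl_gen free" where
  "aw_to_tl = free_eval cst (\<lambda>g. case g of GA \<Rightarrow> tlA | GB \<Rightarrow> tlB | GD \<Rightarrow> tlD | GK \<Rightarrow> tlK | _ \<Rightarrow> cst a)"

definition tl_to_aw :: "tl_gen free \<Rightarrow> aw_gen free" where
  "tl_to_aw = free_eval cst (\<lambda>g. case g of S1 \<Rightarrow> cst \<delta> - Atilde q | S2 \<Rightarrow> cst \<delta> - Btilde q)"

sublocale f: free_hom cst aw_to_tl
  unfolding aw_to_tl_def by (rule central_scalars.free_hom_free_eval[OF central_scalars_cst])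

sublocale g: free_hom cst tl_to_aw
  unfolding tl_to_aw_def by (rule central_scalars.free_hom_free_eval[OF central_scalars_cst])

sublocale r: free_hom tlm_scal "tl_repr q"
  by (rule free_hom_tl_repr)

lemma aw_to_tl_gen:
  "aw_to_tl gA = tlA" "aw_to_tl gB = tlB" "aw_to_tl gD = tlD" "aw_to_tl gK = tlK"
  "aw_to_tl \<alpha>1 = cst a" "aw_to_tl \<alpha>2 = cst a" "aw_to_tl \<alpha>3 = cst a"
  by (simp_all add: aw_to_tl_def central_scalars.free_eval_gen[OF central_scalars_cst])

lemma tl_to_aw_gen: "tl_to_aw \<sigma>1 = cst \<delta> - Atilde q" "tl_to_aw \<sigma>2 = cst \<delta> - Btilde q"
  by (simp_all add: tl_to_aw_def central_scalars.free_eval_gen[OF central_scalars_cst])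

text \<open>Since \<open>tl_repr\<close> has the Temperley-Lieb ideal as kernel, a relator maps to
  zero in the Temperley-Lieb algebra as soon as this composite kills it.\<close>

definition aw_repr :: "aw_gen free \<Rightarrow> tlm" where "aw_repr x = tl_repr q (aw_to_tl x)"

sublocale h: free_hom tlm_scal aw_repr
  by standard (simp_all add: aw_repr_def f.simps r.simps)

section \<open>Verification of the Askey-Wilson relators in the matrix representation\<close>

lemma powi_values: "q powi 2 = q\<^sup>2" "q powi - 2 = p\<^sup>2"
  by (simp_all add: power_int_def power_inverse)

lemma aw_repr_ABK:
  "aw_repr gA = TLM \<delta> (- c) 0 (chi q 1) (chi q 1)"
  "aw_repr gB = TLM (chi q 1) 0 (- c) \<delta> (chi q 1)"
  "aw_repr gK = TLM a 0 0 a (chi q (3/2))"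
  "aw_repr \<alpha>1 = tlm_scal a" "aw_repr \<alpha>2 = tlm_scal a" "aw_repr \<alpha>3 = tlm_scal a"
  by (simp_all add: aw_repr_def aw_to_tl_gen tlA_def tlB_def tlK_def r.simps tl_repr_gen tlm_scal_def
      chi_eqs(4,5) algebra_simps) (simp_all add: power2_eq_square algebra_simps)

text \<open>Multiplying by \<open>q\<^sup>2 - p\<^sup>2 = (q - p) * \<delta>\<close> clears both
  denominators and leaves an identity of Laurent polynomials.\<close>

lemma tlm_commutator_eqI:
  assumes "tlm_scal (q\<^sup>2 - p\<^sup>2) * Z = tlm_scal (q - p) * X - Y"
  shows "tlm_scal (1 / \<delta>) * X - tlm_scal (1 / (q\<^sup>2 - p\<^sup>2)) * Y = Z"
proof -
  interpret central_scalars tlm_scal by (rule central_scalars_tlm)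
  let ?d = "q\<^sup>2 - p\<^sup>2"
  have "?d = (q - p) * \<delta>" by (simp add: algebra_simps power2_eq_square)
  then have "1 / \<delta> = 1 / ?d * (q - p)" using nonzero(1,4) by auto
  then have "tlm_scal (1 / \<delta>) * X - tlm_scal (1 / ?d) * Y = tlm_scal (1 / ?d) * (tlm_scal (q - p) * X - Y)"
    by (simp only: s_mult mult.assoc right_diff_distrib[of "tlm_scal _"])
  also have "\<dots> = Z"
    using nonzero(4) by (simp only: assms[symmetric] mult.assoc[symmetric] s_mult[symmetric])
      (simp add: s_one)
  finally show ?thesis .
qed

text \<open>The entries solve the third relation. Exchanging \<open>q\<close> and \<open>p\<close>
  turns the first value into the second, in accordance with the reversed q-commutator.\<close>

lemma aw_repr_D:
  "aw_repr gD = TLM (p ^ 3 + 2 * q - p) (c * p\<^sup>2) (c * q\<^sup>2) (q ^ 3 - q + 2 * p) (chi q 1)"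
  "aw_repr (Dprime q) = TLM (q ^ 3 + 2 * p - q) (c * q\<^sup>2) (c * p\<^sup>2) (p ^ 3 - p + 2 * q) (chi q 1)"
proof -
  have D: "aw_repr gD = tlm_scal (1 / \<delta>) * (tlm_scal (a * a) + tlm_scal a * aw_repr gK)
    - tlm_scal (1 / (q powi 2 - q powi -2)) * (tlm_scal q * aw_repr gA * aw_repr gB - tlm_scal p * aw_repr gB * aw_repr gA)"
    by (simp add: aw_repr_def aw_to_tl_gen tlD_def qcomm_def f.simps r.simps)
  show "aw_repr gD = TLM (p ^ 3 + 2 * q - p) (c * p\<^sup>2) (c * q\<^sup>2) (q ^ 3 - q + 2 * p) (chi q 1)"
    unfolding D powi_values
    by (rule tlm_commutator_eqI)
      (use q_nonzero in \<open>simp add: aw_repr_ABK tlm_scal_def chi_values field_simps eval_nat_numeral\<close>)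
  show "aw_repr (Dprime q) = TLM (q ^ 3 + 2 * p - q) (c * q\<^sup>2) (c * p\<^sup>2) (p ^ 3 - p + 2 * q) (chi q 1)"
    unfolding Dprime_def qcomm_def h.simps powi_values
    by (rule tlm_commutator_eqI)
      (use q_nonzero in \<open>simp add: aw_repr_ABK tlm_scal_def chi_values field_simps eval_nat_numeral\<close>)
qed

lemma aw_repr_aw3_rels:
  assumes "r \<in> aw3_rels q"
  shows "aw_repr r = 0"
proof -
  interpret central_scalars tlm_scal by (rule central_scalars_tlm)
  have central: "aw_repr (gen z) * y = y * aw_repr (gen z)" if "z \<in> {G\<alpha>1, G\<alpha>2, G\<alpha>3, GK}" for y z
    using that by (cases y) (auto simp: aw_repr_ABK tlm_scal_def)
  have *: "x + tlm_scal (1 / (q\<^sup>2 - p\<^sup>2)) * y - tlm_scal (1 / \<delta>) * z = 0"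
    if "tlm_scal (q\<^sup>2 - p\<^sup>2) * x = tlm_scal (q - p) * z - y" for x y z
    using tlm_commutator_eqI[OF that] by (simp add: algebra_simps)
  from assms consider
      z g where "r = gen z * gen g - gen g * gen z" "z \<in> {G\<alpha>1, G\<alpha>2, G\<alpha>3, GK}"
    | "r = gA + cst (1 / (q powi 2 - q powi -2)) * qcomm q gB gD - cst (1 / \<delta>) * (\<alpha>1 * \<alpha>2 + \<alpha>3 * gK)"
    | "r = gB + cst (1 / (q powi 2 - q powi -2)) * qcomm q gD gA - cst (1 / \<delta>) * (\<alpha>2 * \<alpha>3 + \<alpha>1 * gK)"
    | "r = gD + cst (1 / (q powi 2 - q powi -2)) * qcomm q gA gB - cst (1 / \<delta>) * (\<alpha>1 * \<alpha>3 + \<alpha>2 * gK)"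
    unfolding aw3_rels_def by blast
  then show ?thesis
  proof cases
    case 1
    then show ?thesis using central[of z] by (simp only: h.simps) simp
  next
    case 2
    show ?thesis
      unfolding 2 qcomm_def h.simps powi_values
      by (rule *) (use q_nonzero in \<open>simp add: aw_repr_ABK aw_repr_D tlm_scal_def chi_values field_simps eval_nat_numeral\<close>)
  next
    case 3
    show ?thesis
      unfolding 3 qcomm_def h.simps powi_values
      by (rule *) (use q_nonzero in \<open>simp add: aw_repr_ABK aw_repr_D tlm_scal_def chi_values field_simps eval_nat_numeral\<close>)
  next
    case 4
    show ?thesis
      unfolding 4 qcomm_def h.simps powi_values
      by (rule *) (use q_nonzero in \<open>simp add: aw_repr_ABK aw_repr_D tlm_scal_def chi_values field_simps eval_nat_numeral\<close>)
  qed
qed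

lemma q_p_cancel: "q * inverse q = 1" "q * (inverse q * x) = x"
  using q_nonzero by simp_all

lemmas laurent_simps = chi_values algebra_simps eval_nat_numeral q_p_cancel

lemma aw_repr_lin_prod_A_B_K:
  "aw_repr (lin_prod (chi q) (J2 (1/2) (1/2)) gA) = 0" "aw_repr (lin_prod (chi q) (J2 (1/2) (1/2)) gB) = 0"
  "aw_repr (lin_prod (chi q) (J3 (1/2) (1/2) (1/2)) gK) = 0"
  by (simp_all add: lin_prod_J2 lin_prod_J3 h.simps aw_repr_ABK tlm_scal_def zero_tlm_def chi_eqs(3) algebra_simps)

lemma aw_repr_lin_prod_D:
  "aw_repr (lin_prod (chi q) (J2 (1/2) (1/2)) gD) = 0"
  "aw_repr (lin_prod (chi q) (J2 (1/2) (1/2)) (Dprime q)) = 0"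
  by (simp_all add: lin_prod_J2 h.simps aw_repr_D tlm_scal_def zero_tlm_def laurent_simps)

text \<open>On the matrix part \<open>K\<close> is the number \<open>a\<close>, so the first two
  factors multiply to the quadratic polynomial of \<open>x\<close>, which vanishes. On the scalar
  part \<open>K\<close> and \<open>x\<close> take the values at spins 3/2 and 1, and the third
  factor vanishes.\<close>

lemma aw_repr_lin_prod_K_diff:
  assumes x: "aw_repr x = TLM s t u v (chi q 1)" and x2: "aw_repr (lin_prod (chi q) (J2 (1/2) (1/2)) x) = 0"
  shows "aw_repr (lin_prod (\<lambda>m. m) (Mset q (1/2) (1/2) (1/2)) (gK - x)) = 0"
proof -
  have "(s - chi q 0) * (s - chi q 1) + t * u = 0" "(s - chi q 0) * t + t * (v - chi q 1) = 0"
    "u * (s - chi q 1) + (v - chi q 0) * u = 0" "u * t + (v - chi q 0) * (v - chi q 1) = 0"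
    using x2 by (simp_all add: lin_prod_J2 h.simps x tlm_scal_def zero_tlm_def)
  then have "(chi q 0 - s) * (chi q 1 - s) + t * u = 0" "(chi q 0 - s) * (- t) + (- t) * (chi q 1 - v) = 0"
    "(- u) * (chi q 1 - s) + (chi q 0 - v) * (- u) = 0" "u * t + (chi q 0 - v) * (chi q 1 - v) = 0"
    by (simp_all add: algebra_simps)
  then have "aw_repr ((gK - x - cst (a - chi q 0)) * (gK - x - cst (a - chi q 1)))
      = TLM 0 0 0 0 ((chi q (3/2) - chi q 1 - (a - chi q 0)) * (chi q (3/2) - chi q 1 - (a - chi q 1)))"
    by (simp add: h.simps x aw_repr_ABK tlm_scal_def)
  then show ?thesis
    unfolding lin_prod_Mset mult.assoc[symmetric] h.mult[of "_ * _"]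
    by (simp add: h.simps x aw_repr_ABK tlm_scal_def zero_tlm_def)
qed

lemma aw_repr_Omega:
  "aw_repr (\<Omega> q - (cst (a ^ 2 + a ^ 2 + a ^ 2) + gK * gK + cst (a * a * a) * gK - cst (\<delta> ^ 2))) = 0"
  by (simp add: \<Omega>_def powi_values h.simps aw_repr_ABK aw_repr_D tlm_scal_def zero_tlm_def laurent_simps)

lemma aw_repr_awbar_rels:
  assumes "r \<in> awbar_rels q (1/2) (1/2) (1/2)"
  shows "aw_repr r = 0"
proof -
  have \<alpha>: "aw_repr (\<alpha>1 - cst a) = 0" "aw_repr (\<alpha>2 - cst a) = 0" "aw_repr (\<alpha>3 - cst a) = 0"
    by (simp_all add: h.simps aw_repr_ABK)
  note quad = aw_repr_lin_prod_A_B_K aw_repr_lin_prod_D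
  note K = aw_repr_lin_prod_K_diff[OF aw_repr_ABK(1) quad(1)] aw_repr_lin_prod_K_diff[OF aw_repr_ABK(2) quad(2)]
    aw_repr_lin_prod_K_diff[OF aw_repr_D(1) quad(4)] aw_repr_lin_prod_K_diff[OF aw_repr_D(2) quad(5)]
  show ?thesis
    using assms unfolding awbar_rels_def by (elim insertE emptyE; simp only: \<alpha> quad K aw_repr_Omega)
qed

end

section \<open>The isomorphism\<close>

context not_root_of_unity
begin

abbreviation "AW \<equiv> AWbar q (1/2) (1/2) (1/2)"
abbreviation "AW_cls \<equiv> AWbar_cls q (1/2) (1/2) (1/2)"

definition N :: "aw_gen free set" where "N = {x. AW_cls x = \<zero>\<^bsub>AW\<^esub>}"

lemma N_ideal: "free_ideal N"
proof -
  have "ideal (a_kernel free_alg AW AW_cls) free_alg"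
    by (rule ring_hom_ring.kernel_is_ideal[OF ring_hom_ring_AWbar_cls])
  then show ?thesis
    unfolding free_ideal_def a_kernel_def' N_def free_alg_simps by (simp only: UNIV_I simp_thms)
qed

sublocale N: free_ideal N by (rule N_ideal)

lemma rels_N: "aw3_rels q \<subseteq> N" "awbar_rels q (1/2) (1/2) (1/2) \<subseteq> N"
  unfolding N_def by (rule subsetI, rule CollectI, rule AWbar_rels_zero, blast)+

lemma awbar_rels_N:
  "\<alpha>1 - cst a \<in> N" "\<alpha>2 - cst a \<in> N" "\<alpha>3 - cst a \<in> N"
  "lin_prod (chi q) (J2 (1/2) (1/2)) gA \<in> N" "lin_prod (chi q) (J2 (1/2) (1/2)) gB \<in> N"
  "lin_prod (chi q) (J3 (1/2) (1/2) (1/2)) gK \<in> N" "lin_prod (chi q) (J2 (1/2) (1/2)) gD \<in> N"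
  "lin_prod (\<lambda>m. m) (Mset q (1/2) (1/2) (1/2)) (gK - gA) \<in> N"
  "lin_prod (\<lambda>m. m) (Mset q (1/2) (1/2) (1/2)) (gK - gB) \<in> N"
  using rels_N(2) unfolding awbar_rels_def insert_subset by blast+

lemma aw3_rels_N:
  "z \<in> {G\<alpha>1, G\<alpha>2, G\<alpha>3, GK} \<Longrightarrow> gen z * gen g - gen g * gen z \<in> N"
  "gA + cst (1 / (q powi 2 - q powi -2)) * qcomm q gB gD - cst (1 / \<delta>) * (\<alpha>1 * \<alpha>2 + \<alpha>3 * gK) \<in> N"
  "gB + cst (1 / (q powi 2 - q powi -2)) * qcomm q gD gA - cst (1 / \<delta>) * (\<alpha>2 * \<alpha>3 + \<alpha>1 * gK) \<in> N"
  "gD + cst (1 / (q powi 2 - q powi -2)) * qcomm q gA gB - cst (1 / \<delta>) * (\<alpha>1 * \<alpha>3 + \<alpha>2 * gK) \<in> N"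
  using rels_N(1) unfolding aw3_rels_def Un_subset_iff insert_subset by blast+

text \<open>With all \<open>\<alpha>\<close> equal to \<open>a\<close>, the three Askey-Wilson
  relations share one right-hand side, as \<open>aw_half\<close> requires.\<close>

lemma alpha_eliminate:
  assumes "x - cst r * (\<alpha> * \<beta> + \<gamma> * gK) \<in> N" "\<alpha> - cst a \<in> N" "\<beta> - cst a \<in> N" "\<gamma> - cst a \<in> N"
  shows "x - cst r * (cst (a * a) + cst a * gK) \<in> N"
proof -
  have "x - cst r * (cst (a * a) + cst a * gK) = (x - cst r * (\<alpha> * \<beta> + \<gamma> * gK))
    + cst r * ((\<alpha> - cst a) * \<beta> + cst a * (\<beta> - cst a) + (\<gamma> - cst a) * gK)"
    by (simp add: algebra_simps cst_mult)
  also have "\<dots> \<in> N" using assms by (intro N.N_add N.N_lmult N.N_rmult)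
  finally show ?thesis .
qed

lemma aw_half: "aw_half N gA gB gD gK (Atilde q) (Btilde q) (cst (1 / c) * (gK - cst a)) q p a (chi q (3/2)) c (q\<^sup>2 - p\<^sup>2)
  (chi q 1) \<delta> (chi q) (J2 (1/2) (1/2)) (\<lambda>m. m) (Mset q (1/2) (1/2) (1/2)) (Mset q (1/2) (1/2) (1/2))"
proof (intro aw_half.intro aw_half_axioms.intro N.free_ideal_axioms nonzero(1-4))
  have "q \<noteq> p" using nonzero(2) by auto
  then show "gA = cst c * Atilde q + cst \<delta>" "gB = cst c * Btilde q + cst \<delta>"
    by (rule Atilde_Btilde_eqs)+
  show "gK * gA - gA * gK \<in> N" "gK * gB - gB * gK \<in> N"
    by (rule aw3_rels_N(1), simp)+
  show "gK = cst c * (cst (1 / c) * (gK - cst a)) + cst a"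
    using nonzero(2) by (simp add: cst_1 flip: cst_mult mult.assoc)
  show "(gA - cst \<delta>) * (gA - cst (chi q 1)) \<in> N" "(gB - cst \<delta>) * (gB - cst (chi q 1)) \<in> N"
    "(gK - cst (chi q (3/2))) * (gK - cst a) \<in> N"
    using awbar_rels_N(4-6) unfolding lin_prod_J2 lin_prod_J3 chi_eqs(3) .
  show "finite (J2 (1/2) (1/2))" "finite (Mset q (1/2) (1/2) (1/2))" "finite (Mset q (1/2) (1/2) (1/2))"
    by (simp_all add: J2_values Mset_half)
  show "2 * a * a / \<delta> - \<delta> \<noteq> chi q j" if "j \<in> J2 (1/2) (1/2)" for j
    using not_in_J2[OF that] .
  show "chi q (3/2) - \<delta> \<noteq> m" "chi q (3/2) - \<delta> \<noteq> m" if "m \<in> Mset q (1/2) (1/2) (1/2)" for m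
    using not_in_Mset[OF that] by (simp_all add: chi_eqs(3))
  note r = aw3_rels_N(2-4)[unfolded powi_values qcomm_def]
  show "gA + cst (1 / (q\<^sup>2 - p\<^sup>2)) * (cst q * gB * gD - cst p * gD * gB) - cst (1 / \<delta>) * (cst (a * a) + cst a * gK) \<in> N"
    by (rule alpha_eliminate[OF r(1)]) (rule awbar_rels_N)+
  show "gB + cst (1 / (q\<^sup>2 - p\<^sup>2)) * (cst q * gD * gA - cst p * gA * gD) - cst (1 / \<delta>) * (cst (a * a) + cst a * gK) \<in> N"
    by (rule alpha_eliminate[OF r(2)]) (rule awbar_rels_N)+
  show "gD + cst (1 / (q\<^sup>2 - p\<^sup>2)) * (cst q * gA * gB - cst p * gB * gA) - cst (1 / \<delta>) * (cst (a * a) + cst a * gK) \<in> N"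
    by (rule alpha_eliminate[OF r(3)]) (rule awbar_rels_N)+
qed (simp_all only: awbar_rels_N chi_values refl, use q_nonzero in simp_all)

lemma tl_to_aw_rels: "r \<in> tl_rels q \<Longrightarrow> tl_to_aw r \<in> N"
  using aw_half.TL_relations(1-4)[OF aw_half]
  by (auto simp: tl_rels_def g.simps tl_to_aw_gen simp flip: mult.assoc)

text \<open>This expresses that \<open>Atilde\<close> and \<open>Btilde\<close> generate the
  quotient: \<open>K\<close> is recovered from them by \<open>TL_relations\<close>, and then
  \<open>D\<close> by the third Askey-Wilson relation.\<close>

lemma tl_to_aw_aw_to_tl: "tl_to_aw (aw_to_tl x) - x \<in> N"
proof (induction x rule: free_alg_induct)
  case (cst c)
  then show ?case by (simp add: f.simps g.simps N.N_zero)
next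
  case (add x y)
  have eq: "tl_to_aw (aw_to_tl (x + y)) - (x + y) = (tl_to_aw (aw_to_tl x) - x) + (tl_to_aw (aw_to_tl y) - y)"
    by (simp add: f.simps g.simps)
  show ?case unfolding eq by (rule N.N_add[OF add])
next
  case (gen_mult h x)
  have "q \<noteq> p" using nonzero(2) by auto
  note AB = Atilde_Btilde_eqs[OF this]
  have e: "cst (chi q 1) - cst c * (cst \<delta> - u) = cst c * u + cst \<delta>" for u :: "aw_gen free"
    unfolding chi_eqs(4) cst_add[of \<delta> "c * \<delta>"] cst_mult[of c \<delta>] by (simp add: algebra_simps)
  have A: "tl_to_aw tlA = gA" and B: "tl_to_aw tlB = gB"
    unfolding tlA_def tlB_def g.simps tl_to_aw_gen
    by (rule trans[OF e AB(1)[symmetric]], rule trans[OF e AB(2)[symmetric]])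
  have K: "gK - tl_to_aw tlK \<in> N"
    using aw_half.TL_relations(5)[OF aw_half] by (simp add: tlK_def g.simps tl_to_aw_gen)
  \<comment> \<open>Both elements solve the third relation modulo \<open>N\<close>, one with
    \<open>tl_to_aw tlK\<close> in place of \<open>gK\<close>, so their difference is a multiple of
    the difference of these two.\<close>
  have "tl_to_aw tlD - gD = cst (- (a / \<delta>)) * (gK - tl_to_aw tlK)
      - (gD + cst (1 / (q\<^sup>2 - p\<^sup>2)) * (cst q * gA * gB - cst p * gB * gA) - cst (1 / \<delta>) * (cst (a * a) + cst a * gK))"
    by (simp add: tlD_def g.simps A B qcomm_def powi_values algebra_simps cst_simps)
  also have "\<dots> \<in> N"
    by (rule N.N_diff[OF N.N_lmult[OF K] aw_half.rD[OF aw_half]])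
  finally have D: "tl_to_aw tlD - gD \<in> N" .
  have "gen h = gA \<or> gen h = gB \<or> gen h = gD \<or> gen h = gK \<or> gen h = \<alpha>1 \<or> gen h = \<alpha>2 \<or> gen h = \<alpha>3"
    by (cases h) auto
  then have gen: "tl_to_aw (aw_to_tl (gen h)) - gen h \<in> N"
    using D N.N_diff[OF N.N_zero K] N.N_diff[OF N.N_zero awbar_rels_N(1)]
      N.N_diff[OF N.N_zero awbar_rels_N(2)] N.N_diff[OF N.N_zero awbar_rels_N(3)]
    by (elim disjE) (simp_all add: aw_to_tl_gen A B g.simps N.N_zero)
  have eq: "tl_to_aw (aw_to_tl (gen h * x)) - gen h * x
    = (tl_to_aw (aw_to_tl (gen h)) - gen h) * tl_to_aw (aw_to_tl x) + gen h * (tl_to_aw (aw_to_tl x) - x)"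
    by (simp add: f.simps g.simps algebra_simps)
  show ?case unfolding eq by (rule N.N_add[OF N.N_rmult[OF gen] N.N_lmult[OF gen_mult]])
qed

lemma aw_to_tl_tildes:
  "aw_to_tl (Atilde q) = cst \<delta> - \<sigma>1" "aw_to_tl (Btilde q) = cst \<delta> - \<sigma>2"
proof -
  have "cst (1 / r) * (cst (t + r * t) - cst r * x - cst t) = cst t - x" if "r \<noteq> 0" for r t and x :: "tl_gen free"
  proof -
    have "cst (t + r * t) - cst r * x - cst t = cst r * (cst t - x)"
      by (simp add: cst_add cst_mult algebra_simps)
    then show ?thesis using that by (simp add: cst_merge cst_1)
  qed
  from this[OF nonzero(2)]
show "aw_to_tl (Atilde q) = cst \<delta> - \<sigma>1" "aw_to_tl (Btilde q) = cst \<delta> - \<sigma>2"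
    by (simp_all only: Atilde_def Btilde_def f.simps aw_to_tl_gen tlA_def tlB_def chi_eqs(4))
qed

text \<open>This holds already in the free algebra, since the images of \<open>Atilde\<close> and
  \<open>Btilde\<close> are exactly \<open>\<delta> - \<sigma>1\<close> and
  \<open>\<delta> - \<sigma>2\<close>; it supplies surjectivity.\<close>

lemma aw_to_tl_tl_to_aw: "aw_to_tl (tl_to_aw y) = y"
proof (induction y rule: free_alg_induct)
  case (gen_mult h x)
  have "gen h = \<sigma>1 \<or> gen h = \<sigma>2" by (cases h) auto
  then have "aw_to_tl (tl_to_aw (gen h)) = gen h"
    by (elim disjE) (simp_all add: tl_to_aw_gen f.simps aw_to_tl_tildes)
  then show ?case using gen_mult by (simp add: f.simps g.simps)
qed (simp_all add: f.simps g.simps)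

lemma aw_to_tl_mem_iff: "aw_to_tl x \<in> Idl\<^bsub>free_alg\<^esub> (tl_rels q) \<longleftrightarrow> x \<in> N"
proof
  assume "x \<in> N"
  \<comment> \<open>The kernel of \<open>aw_repr\<close> is an ideal containing all relators, hence
    contains \<open>N\<close>; faithfulness of \<open>tl_repr\<close> uses
    \<open>\<delta>\<^sup>2 \<noteq> 1\<close>.\<close>
  have "aw3_rels q \<union> awbar_rels q (1/2) (1/2) (1/2) \<subseteq> {x. aw_repr x = 0}"
    using aw_repr_aw3_rels aw_repr_awbar_rels by blast
  from AWbar_kernel_minimal[OF h.kernel_ideal this] have "aw_repr x = 0"
    using \<open>x \<in> N\<close> unfolding N_def by blast
  then show "aw_to_tl x \<in> Idl\<^bsub>free_alg\<^esub> (tl_rels q)"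
    using nonzero(5) by (intro tl_repr_kernel) (simp_all add: aw_repr_def)
next
  \<comment> \<open>The preimage of \<open>N\<close> is an ideal containing the Temperley-Lieb
    relators. Hence \<open>tl_to_aw (aw_to_tl x)\<close> is in \<open>N\<close>, and it is congruent
    to \<open>x\<close>.\<close>
  let ?J = "{y. tl_to_aw y \<in> N}"
  assume x: "aw_to_tl x \<in> Idl\<^bsub>free_alg\<^esub> (tl_rels q)"
  have "ideal ?J free_alg"
  proof (rule idealI[OF ring_free_alg])
    interpret R: ring "free_alg :: (complex, tl_gen free) module" by (rule ring_free_alg)
    have inv: "inv\<^bsub>add_monoid free_alg\<^esub> x = - x" for x :: "tl_gen free"
      using minus_free_alg[of 0 x] by (simp add: a_minus_def a_inv_def del: minus_free_alg)
    show "subgroup ?J (add_monoid free_alg)"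
    proof (rule group.subgroupI[OF R.add.is_group])
      show "inv\<^bsub>add_monoid free_alg\<^esub> x \<in> ?J" if "x \<in> ?J" for x
        using that N.N_diff[OF N.N_zero, of "tl_to_aw x"] unfolding inv by (simp add: g.simps)
    qed (auto simp: g.simps N.N_add N.N_zero intro: exI[of _ 0])
  qed (auto simp: g.simps N.N_lmult N.N_rmult)
  from ring.genideal_minimal[OF ring_free_alg this, of "tl_rels q"] tl_to_aw_rels x
  have "tl_to_aw (aw_to_tl x) \<in> N" by blast
  from N.N_diff[OF this tl_to_aw_aw_to_tl[of x]] show "x \<in> N" by simp
qed

lemma isomorphism: "\<exists>\<Phi>\<in>alg_iso AW (TL3 q). \<forall>x. \<Phi> (AW_cls x) = TL3_cls q (aw_to_tl x)"
proof (rule alg_iso_factor[OF ring_hom_ring_AWbar_cls carrier_AWbar AWbar_smult])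
  show hom: "ring_hom_ring free_alg (TL3 q) (TL3_cls q)"
    using ring_hom_ring_alg_cls[OF ring_free_alg, of "tl_rels q"] by (simp add: TL3_def TL3_cls_def[abs_def])
  then interpret t: ring_hom_ring free_alg "TL3 q" "TL3_cls q" .
  show "carrier (TL3 q) = range (TL3_cls q)"
    by (auto simp: TL3_def TL3_cls_def carrier_alg_quot)
  show "c \<odot>\<^bsub>TL3 q\<^esub> X = TL3_cls q (cst c) \<otimes>\<^bsub>TL3 q\<^esub> X" if "X \<in> carrier (TL3 q)" for c X
    using alg_quot_smult[of X "tl_rels q" c] that by (simp add: TL3_def TL3_cls_def)
  show "free_hom cst aw_to_tl" by (rule f.free_hom_axioms)
  show "\<exists>x. TL3_cls q (aw_to_tl x) = TL3_cls q y" for y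
    using aw_to_tl_tl_to_aw by metis
  show "AW_cls x = \<zero>\<^bsub>AW\<^esub> \<longleftrightarrow> TL3_cls q (aw_to_tl x) = \<zero>\<^bsub>TL3 q\<^esub>" for x
  proof -
    have "TL3_cls q (aw_to_tl x) = TL3_cls q 0 \<longleftrightarrow> aw_to_tl x \<in> Idl\<^bsub>free_alg\<^esub> (tl_rels q)"
      unfolding TL3_cls_def by (subst alg_cls_eq_iff[OF ring_free_alg]) simp_all
    then show ?thesis
      using t.hom_zero aw_to_tl_mem_iff[of x] by (simp add: N_def)
  qed
qed

end

theorem theorem6p2:
  fixes q :: complex
  assumes "q \<noteq> 0" and "\<forall>n::nat. n > 0 \<longrightarrow> q ^ n \<noteq> 1"
  shows "\<exists>\<Phi> \<in> alg_iso (AWbar q (1/2) (1/2) (1/2)) (TL3 q).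
           \<Phi> (AWbar_cls q (1/2) (1/2) (1/2) (Atilde q)) = TL3_cls q (cst (q + inverse q) - \<sigma>1) \<and>
           \<Phi> (AWbar_cls q (1/2) (1/2) (1/2) (Btilde q)) = TL3_cls q (cst (q + inverse q) - \<sigma>2)"
proof -
  interpret not_root_of_unity q by standard (use assms in auto)
  show ?thesis using isomorphism by (metis aw_to_tl_tildes)
qed

end
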